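(* Let $\tau_{n,m}^N=T_1^nT_2^mT_4^N(\tau_1)$ ($n,m,N\in\mathbb{Z}$) be the $\tau$ function on the lattice of type $A_2\times A_1$ of the Painlevé system of type $(A_2+A_1)^{(1)}$, as defined in the context. 1. The $\tau$ function satisfies the bilinear equations $$\tau^{N+1}\tau_{n+1}^{N-1}-Q^{4N}\gamma^4\,\tau_{n+1}^{N+1}\tau^{N-1}+Q^{4n-2m-4N}\gamma^{-4}\alpha_0^6\alpha_1^2\alpha_2^4\,(Q^{12N}\gamma^{12}-1)\,\tau_{n+1}\tau=0,$$ $$\tau^{N+1}\tau_{m+1}^{N-1}-Q^{4N}\gamma^4\,\tau_{m+1}^{N+1}\tau^{N-1}+Q^{4m-2n-4N}\gamma^{-4}\alpha_1^2\alpha_2^{-2}\,(Q^{12N}\gamma^{12}-1)\,\tau_{m+1}\tau=0,$$ where $\alpha_i=a_i^{1/6}$, $\gamma=c^{1/6}$, $Q=q^{1/6}$. 2. For fixed $N$, the function $$z=z_{n,m}=(Q^{4N+4}\gamma^4)^{n+m}\,\frac{\tau^{N+2}}{\tau}$$ satisfies the discrete Schwarzian KdV equation $$\frac{(z-z_{n+1})(z_{n+1,m+1}-z_{m+1})}{(z_{n+1}-z_{n+1,m+1})(z_{m+1}-z)}=q^{2n-2m}a_0^2a_2^2 .$$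
   Context: Notation: only shifted variables among $(n,m,N)$ are displayed: $\tau=\tau_{n,m}^N$, $\tau_{n+1}^{N-1}=\tau_{n+1,m}^{N-1}$, $z_{m+1}=z_{n,m+1}$, etc. Indices of $a_i,\alpha_i,f_i,u_i,v_i,\tau_i,\overline\tau_i$ are in $\mathbb{Z}/3\mathbb{Z}$. Parameters: $\alpha_0,\alpha_1,\alpha_2,\gamma$ are independent variables over $\mathbb{C}$; $a_i=\alpha_i^6$, $c=\gamma^6$, $Q=\alpha_0\alpha_1\alpha_2$, $q=Q^6=a_0a_1a_2$. All fractional powers are the ones determined by these, e.g. $a_i^{1/3}=\alpha_i^2$, $q^{1/3}c^{2/3}=Q^2\gamma^4$. Consider the field of rational functions in the independent variables $\tau_i,\overline\tau_i$ ($i\in\mathbb{Z}/3\mathbb{Z}$) over $\mathbb{C}(\alpha_0,\alpha_1,\alpha_2,\gamma)$. Put $$f_i=q^{\frac13}c^{\frac23}\,\frac{\overline\tau_{i+1}\tau_{i-1}}{\tau_{i+1}\overline\tau_{i-1}},\qquad u_i=q^{-\frac13}c^{-\frac23}a_i,\qquad v_i=q^{\frac13}c^{\frac23}a_i,$$ with $u_i^{1/2}=Q^{-1}\gamma^{-2}\alpha_i^3$, $v_i^{1/2}=Q\gamma^2\alpha_i^3$ (so $f_0f_1f_2=qc^2$). The transformations $s_0,s_1,s_2,\pi,w_0,r$ are the field automorphisms (over $\mathbb{C}$) given as follows. On parameters: $s_i(a_i)=a_i^{-1}$, $s_i(a_j)=a_ia_j$ ($j\ne i$), $\pi(a_j)=a_{j+1}$,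 $w_0(a_j)=r(a_j)=a_j$ (likewise with $\alpha$ in place of $a$); $s_i(c)=\pi(c)=c$, $w_0(c)=c^{-1}$, $r(c)=q^{-1}c^{-1}$ (likewise $w_0(\gamma)=\gamma^{-1}$, $r(\gamma)=Q^{-1}\gamma^{-1}$, and $\gamma$ fixed by $s_i,\pi$). On $\tau$ variables: $$s_i(\tau_i)=u_i^{\frac12}\Big(1+\frac{f_i}{a_i}\Big)\frac{\tau_{i+1}\overline\tau_{i-1}}{\overline\tau_i},\quad s_i(\overline\tau_i)=v_i^{-\frac12}(1+a_if_i)\frac{\tau_{i+1}\overline\tau_{i-1}}{\tau_i},\quad s_i(\tau_j)=\tau_j,\ s_i(\overline\tau_j)=\overline\tau_j\ (i\neq j),$$ $$\pi(\tau_i)=\tau_{i+1},\quad \pi(\overline\tau_i)=\overline\tau_{i+1},\qquad r(\tau_i)=\overline\tau_i,\quad r(\overline\tau_i)=\tau_i,$$ $$w_0(\tau_i)=\tau_i,\qquad w_0(\overline\tau_i)=\Big(\frac{a_{i+1}}{a_{i-1}}\Big)^{\frac13}u_{i-1}\Big(1+\frac{f_{i-1}}{a_{i-1}}+\frac{f_{i-1}f_{i+1}}{a_{i-1}a_{i+1}}\Big)\frac{\tau_i\tau_{i-1}}{\overline\tau_{i-1}} .$$ Products of transformations are compositions of automorphisms, $(gh)(x)=g(h(x))$. The translations are $$T_1=\pi s_2s_1,\qquad T_2=s_1\pi s_2,\qquad T_4=rw_0,$$ which commute with each other and act on parameters by $T_1:(a_0,a_1,a_2,c)\mapsto(qa_0,q^{-1}a_1,a_2,c)$,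 $T_2:(a_0,a_1,a_2,c)\mapsto(a_0,qa_1,q^{-1}a_2,c)$, $T_4:(a_0,a_1,a_2,c)\mapsto(a_0,a_1,a_2,qc)$. With $\tau_{n,m}^N=T_1^nT_2^mT_4^N(\tau_1)$ one has $\tau_0=\tau_{-1,0}^0$, $\tau_1=\tau_{0,0}^0$, $\tau_2=\tau_{0,1}^0$, $\overline\tau_0=\tau_{-1,0}^1$, $\overline\tau_1=\tau_{0,0}^1$, $\overline\tau_2=\tau_{0,1}^1$. *)

theory Defs
  imports
    Complex_Main
    "HOL-Library.Poly_Mapping"
    "HOL-Library.Numeral_Type"
    "HOL-Computational_Algebra.Fraction_Field"
begin

section \<open>The field of rational functions\<close>

text \<open>
  The type \<^typ>\<open>3\<close> is the ring of integers modulo 3, so index arithmetic such as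
  \<^term>\<open>i + 1 :: 3\<close> is automatically modulo 3.
\<close>

datatype var = Alpha 3 | Gamma | Tau 3 | Taubar 3

text \<open>
  Some linear order on the variables is needed only because the library proves polynomial rings
  to be integral domains for linearly ordered variables; it plays no other role.
\<close>

primrec var_rank :: "var \<Rightarrow> nat \<times> 3" where
  "var_rank (Alpha i) = (0, i)"
| "var_rank Gamma = (1, 0)"
| "var_rank (Tau i) = (2, i)"
| "var_rank (Taubar i) = (3, i)"

lemma var_rank_inj: "var_rank v = var_rank w \<Longrightarrow> v = w"
  by (cases v; cases w) auto

instantiation var :: linorder
begin

definition less_eq_var :: "var \<Rightarrow> var \<Rightarrow> bool" where
  "v \<le> w \<longleftrightarrow> fst (var_rank v) < fst (var_rank w) \<or>
     fst (var_rank v) = fst (var_rank w) \<and> snd (var_rank v) \<le> snd (var_rank w)"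

definition less_var :: "var \<Rightarrow> var \<Rightarrow> bool" where
  "v < w \<longleftrightarrow> v \<le> w \<and> \<not> w \<le> (v :: var)"

instance
  by standard (auto simp: less_eq_var_def less_var_def intro!: var_rank_inj prod_eqI)

end

text \<open>
  Polynomials are finitely supported functions from monomials (exponent vectors) to coefficients;
  \<open>ratfun\<close> is the field of rational functions over the complex numbers in the ten independent
  variables.
\<close>

type_synonym mpoly10 = "(var \<Rightarrow>\<^sub>0 nat) \<Rightarrow>\<^sub>0 complex"
type_synonym ratfun = "mpoly10 fract"

definition const :: "complex \<Rightarrow> ratfun" where
  "const c = Fract (Poly_Mapping.single 0 c) 1"

definition X :: "var \<Rightarrow> ratfun" where
  "X v = Fract (Poly_Mapping.single (Poly_Mapping.single v 1) 1) 1"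

abbreviation \<alpha> :: "3 \<Rightarrow> ratfun" where "\<alpha> i \<equiv> X (Alpha i)"
abbreviation \<gamma> :: ratfun where "\<gamma> \<equiv> X Gamma"
abbreviation \<tau>v :: "3 \<Rightarrow> ratfun" where "\<tau>v i \<equiv> X (Tau i)"
abbreviation \<tau>bar :: "3 \<Rightarrow> ratfun" where "\<tau>bar i \<equiv> X (Taubar i)"

definition a :: "3 \<Rightarrow> ratfun" where "a i = \<alpha> i ^ 6"
definition Q :: ratfun where "Q = \<alpha> 0 * \<alpha> 1 * \<alpha> 2"
definition q :: ratfun where "q = Q ^ 6"

text \<open>
  Fractional powers of \<open>a\<^sub>i\<close>, \<open>q\<close> and \<open>c = \<gamma>\<^sup>6\<close> are written through \<open>\<alpha>\<^sub>i\<close>, \<open>Q\<close> and \<open>\<gamma>\<close>;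
  \<open>u_half\<close> and \<open>v_half\<close> are the square roots of \<open>u\<close> and \<open>v\<close>.
\<close>

definition f :: "3 \<Rightarrow> ratfun" where
  "f i = Q ^ 2 * \<gamma> ^ 4 * (\<tau>bar (i + 1) * \<tau>v (i - 1)) / (\<tau>v (i + 1) * \<tau>bar (i - 1))"

definition u :: "3 \<Rightarrow> ratfun" where "u i = inverse (Q ^ 2 * \<gamma> ^ 4) * a i"
definition u_half :: "3 \<Rightarrow> ratfun" where "u_half i = inverse (Q * \<gamma> ^ 2) * \<alpha> i ^ 3"
definition v_half :: "3 \<Rightarrow> ratfun" where "v_half i = Q * \<gamma> ^ 2 * \<alpha> i ^ 3"


section \<open>The transformations\<close>

definition C_automorphism :: "(ratfun \<Rightarrow> ratfun) \<Rightarrow> bool" where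
  "C_automorphism h \<longleftrightarrow>
     bij h \<and> (\<forall>x y. h (x + y) = h x + h y) \<and> (\<forall>x y. h (x * y) = h x * h y) \<and>
     (\<forall>c. h (const c) = const c)"

text \<open>
  A \<^const>\<open>C_automorphism\<close> is determined by its values on the variables, so there is at most
  one with prescribed values.  If there is none, \<open>automorphism_with g\<close> is an unspecified function.
\<close>

definition automorphism_with :: "(var \<Rightarrow> ratfun) \<Rightarrow> ratfun \<Rightarrow> ratfun" where
  "automorphism_with g = (THE h. C_automorphism h \<and> (\<forall>v. h (X v) = g v))"

definition s :: "3 \<Rightarrow> ratfun \<Rightarrow> ratfun" where
  "s i = automorphism_with (\<lambda>v. case v of
     Alpha j \<Rightarrow> if j = i then inverse (\<alpha> i) else \<alpha> i * \<alpha> j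
   | Gamma \<Rightarrow> \<gamma>
   | Tau j \<Rightarrow> if j = i
       then u_half i * (1 + f i / a i) * (\<tau>v (i + 1) * \<tau>bar (i - 1) / \<tau>bar i)
       else \<tau>v j
   | Taubar j \<Rightarrow> if j = i
       then inverse (v_half i) * (1 + a i * f i) * (\<tau>v (i + 1) * \<tau>bar (i - 1) / \<tau>v i)
       else \<tau>bar j)"

definition \<pi> :: "ratfun \<Rightarrow> ratfun" where
  "\<pi> = automorphism_with (\<lambda>v. case v of
     Alpha i \<Rightarrow> \<alpha> (i + 1)
   | Gamma \<Rightarrow> \<gamma>
   | Tau i \<Rightarrow> \<tau>v (i + 1)
   | Taubar i \<Rightarrow> \<tau>bar (i + 1))"

definition w0 :: "ratfun \<Rightarrow> ratfun" where
  "w0 = automorphism_with (\<lambda>v. case v of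
     Alpha i \<Rightarrow> \<alpha> i
   | Gamma \<Rightarrow> inverse \<gamma>
   | Tau i \<Rightarrow> \<tau>v i
   | Taubar i \<Rightarrow> (\<alpha> (i + 1) / \<alpha> (i - 1)) ^ 2 * u (i - 1)
       * (1 + f (i - 1) / a (i - 1) + f (i - 1) * f (i + 1) / (a (i - 1) * a (i + 1)))
       * (\<tau>v i * \<tau>v (i - 1) / \<tau>bar (i - 1)))"

definition r :: "ratfun \<Rightarrow> ratfun" where
  "r = automorphism_with (\<lambda>v. case v of
     Alpha i \<Rightarrow> \<alpha> i
   | Gamma \<Rightarrow> inverse Q * inverse \<gamma>
   | Tau i \<Rightarrow> \<tau>bar i
   | Taubar i \<Rightarrow> \<tau>v i)"

definition T1 :: "ratfun \<Rightarrow> ratfun" where "T1 = \<pi> \<circ> s 2 \<circ> s 1"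
definition T2 :: "ratfun \<Rightarrow> ratfun" where "T2 = s 1 \<circ> \<pi> \<circ> s 2"
definition T4 :: "ratfun \<Rightarrow> ratfun" where "T4 = r \<circ> w0"

definition int_iterate :: "('b \<Rightarrow> 'b) \<Rightarrow> int \<Rightarrow> 'b \<Rightarrow> 'b" where
  "int_iterate h k = (if k \<ge> 0 then h ^^ nat k else inv h ^^ nat (- k))"


section \<open>The tau function on the lattice\<close>

definition \<tau> :: "int \<Rightarrow> int \<Rightarrow> int \<Rightarrow> ratfun" where
  "\<tau> n m N = int_iterate T1 n (int_iterate T2 m (int_iterate T4 N (\<tau>v 1)))"

definition z :: "int \<Rightarrow> int \<Rightarrow> int \<Rightarrow> ratfun" where
  "z N n m = (Q powi (4 * N + 4) * \<gamma> ^ 4) powi (n + m) * (\<tau> n m (N + 2) / \<tau> n m N)"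

end

theory Submission
  imports Defs
begin

text \<open>
  All transformations are invertible substitutions of variables. The generators \<open>s\<^sub>i\<close>, \<open>\<pi>\<close> satisfy the
  relations of the extended affine Weyl group of type \<open>A\<^sub>2\<close> and commute with \<open>w0\<close> and \<open>r\<close>, so the
  translations commute and carry the \<open>\<tau>\<close> function at one lattice point to that at any other. It therefore suffices to verify
  each bilinear equation at one lattice point, where it is a direct consequence of the explicit
  form of \<open>w0\<close>. The discrete Schwarzian KdV equation follows because the bilinear equations factorize the
  differences of \<open>z\<close> along the edges of the lattice.
\<close>

subsection \<open>Evaluation of rational functions\<close>

text \<open>Each transformation is a definite description, so nothing is known about it until its
  prescribed values are shown to extend to an automorphism. The obstacle is that a substitution may
  make a denominator vanish. Exhibiting an inverse substitution excludes this: each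
  \<open>s i\<close>, \<open>w0\<close> and \<open>r\<close> is its own inverse, and
  \<open>\<pi>\<close> is undone by the opposite rotation. The bilinear equations come from the
  shape of \<open>w0\<close>. \<open>T4 (\<tau>bar i)\<close> and
  \<open>T4 (\<tau>bar (i + 1))\<close> are three-term sums; in the weighted difference of the first
  two products of the equation, two of the three terms cancel, and the survivor is a multiple of
  \<open>\<tau>bar i * \<tau>bar (i + 1)\<close>. Because indices stay symbolic, both equations are
  instances of this one cyclic relation.\<close>

lemma finite_UNIV_var [simp]: "finite (UNIV :: var set)"
proof -
  have "(UNIV :: var set) = range Alpha \<union> {Gamma} \<union> range Tau \<union> range Taubar"
    by (auto simp: image_iff) (metis var.exhaust)
  then show ?thesis
    by (metis finite.emptyI finite.insertI finite_UnI finite_imageI finite)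
qed

text \<open>The product runs over all ten variables and not over the support of \<open>k\<close>, so
  multiplicativity in \<open>k\<close> is just additivity of exponents.\<close>

definition mono_eval :: "(var \<Rightarrow> ratfun) \<Rightarrow> (var \<Rightarrow>\<^sub>0 nat) \<Rightarrow> ratfun" where
  "mono_eval g k = (\<Prod>v\<in>UNIV. g v ^ Poly_Mapping.lookup k v)"

definition poly_eval :: "(var \<Rightarrow> ratfun) \<Rightarrow> mpoly10 \<Rightarrow> ratfun" where
  "poly_eval g p = (\<Sum>k\<in>Poly_Mapping.keys p. const (Poly_Mapping.lookup p k) * mono_eval g k)"

lemma const_simps [simp]: "const 0 = 0" "const 1 = 1"
  "const (x + y) = const x + const y" "const (x * y) = const x * const y"
  by (simp_all add: const_def fract_collapse single_add mult_single)

lemma mono_eval_simps [simp]: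
  "mono_eval g 0 = 1" "mono_eval g (k + l) = mono_eval g k * mono_eval g l"
  by (simp_all add: mono_eval_def lookup_add power_add prod.distrib)

lemma mono_eval_single [simp]: "mono_eval g (Poly_Mapping.single v 1) = g v"
proof -
  have "mono_eval g (Poly_Mapping.single v 1) = (\<Prod>w\<in>UNIV. if w = v then g v else 1)"
    unfolding mono_eval_def by (rule prod.cong) (auto simp: lookup_single)
  then show ?thesis by simp
qed

lemma poly_eval_single: "poly_eval g (Poly_Mapping.single k c) = const c * mono_eval g k"
  by (simp add: poly_eval_def)

lemma poly_eval_0 [simp]: "poly_eval g 0 = 0"
  by (simp add: poly_eval_def)

lemma poly_eval_1 [simp]: "poly_eval g 1 = 1"
  using poly_eval_single[of g 0 1] by simp

lemma poly_eval_add: "poly_eval g (p + p') = poly_eval g p + poly_eval g p'"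
  unfolding poly_eval_def
  by (rule setsum_keys_plus_distrib) (auto simp: algebra_simps)

lemma poly_mapping_add_single_induct [case_names zero add]:
  fixes p :: "'a \<Rightarrow>\<^sub>0 'b::comm_monoid_add"
  assumes "P 0" "\<And>k c p. P p \<Longrightarrow> P (Poly_Mapping.single k c + p)"
  shows "P p"
proof (induction p rule: update_induct)
  case const
  then show ?case using assms(1) by simp
next
  case (update p k c)
  have "Poly_Mapping.update k c p = Poly_Mapping.single k c + p"
    using update.hyps
    by (intro poly_mapping_eqI) (auto simp: lookup_update lookup_add lookup_single in_keys_iff)
  with update assms(2) show ?case by simp
qed

lemma poly_eval_mult: "poly_eval g (p * p') = poly_eval g p * poly_eval g p'"
proof (induction p rule: poly_mapping_add_single_induct)
  case (add k c p)
  have "poly_eval g (Poly_Mapping.single k c * p') = poly_eval g (Poly_Mapping.single k c) * poly_eval g p'"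
    by (induction p' rule: poly_mapping_add_single_induct)
      (simp_all add: distrib_left poly_eval_add poly_eval_single mult_single mult.assoc mult.left_commute)
  with add show ?case
    by (simp add: distrib_right poly_eval_add)
qed simp

text \<open>Links formal evaluation with the fraction field. Algebraic independence and the
  determination of homomorphisms by the variables both rest on it.\<close>

lemma poly_eval_X: "poly_eval X p = Fract p 1"
proof (induction p rule: poly_mapping_add_single_induct)
  case zero
  then show ?case by (simp add: fract_collapse)
next
  case (add k c p)
  have *: "Fract (Poly_Mapping.single (k + l) 1) 1 =
      Fract (Poly_Mapping.single k 1) 1 * Fract (Poly_Mapping.single l 1) (1 :: mpoly10)" for k l
    by (simp add: mult_single)
  have "Fract (Poly_Mapping.single k 1) 1 = mono_eval X k"
  proof (induction k rule: poly_mapping_add_single_induct)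
    case zero
    show ?case by (simp add: fract_collapse)
  next
    case (add v n k)
    have "Fract (Poly_Mapping.single (Poly_Mapping.single v n) 1) 1 = mono_eval X (Poly_Mapping.single v n)"
    proof (induction n)
      case 0
      show ?case by (simp add: fract_collapse)
    next
      case (Suc n)
      have "Poly_Mapping.single v (Suc n) = Poly_Mapping.single v 1 + Poly_Mapping.single v n"
        by (simp flip: single_add)
      moreover have "Fract (Poly_Mapping.single (Poly_Mapping.single v 1) 1) 1 = X v"
        by (simp add: X_def)
      ultimately show ?case using Suc
        by (simp only: * mono_eval_simps mono_eval_single)
    qed
    with add show ?case
      by (simp only: * mono_eval_simps)
  qed
  moreover have "const c * Fract (Poly_Mapping.single k 1) 1 = Fract (Poly_Mapping.single k c) 1"
    by (simp add: const_def mult_single)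
  ultimately have "poly_eval X (Poly_Mapping.single k c) = Fract (Poly_Mapping.single k c) 1"
    by (simp add: poly_eval_single)
  with add show ?case by (simp add: poly_eval_add)
qed

text \<open>
  Evaluation at \<open>g\<close> is defined on the local ring of fractions whose denominator does not vanish
  at \<open>g\<close>; it is a relation because totality is only known after algebraic independence of \<open>g\<close>.
\<close>

definition evaluates :: "(var \<Rightarrow> ratfun) \<Rightarrow> ratfun \<Rightarrow> ratfun \<Rightarrow> bool" where
  "evaluates g x y \<longleftrightarrow>
     (\<exists>n d. d \<noteq> 0 \<and> poly_eval g d \<noteq> 0 \<and> x = Fract n d \<and> y = poly_eval g n / poly_eval g d)"

text \<open>Cross-multiplying two fractions for \<open>x\<close> gives a polynomial identity, which
  \<open>poly_eval\<close> preserves; the value is independent of the representative.\<close>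

lemma evaluates_unique:
  assumes "evaluates g x y" "evaluates g x y'"
  shows "y = y'"
proof -
  from assms obtain n d n' d' where
    1: "d \<noteq> 0" "poly_eval g d \<noteq> 0" "x = Fract n d" "y = poly_eval g n / poly_eval g d" and
    2: "d' \<noteq> 0" "poly_eval g d' \<noteq> 0" "x = Fract n' d'" "y' = poly_eval g n' / poly_eval g d'"
    unfolding evaluates_def by blast
  then have "n * d' = n' * d" by (metis eq_fract(1))
  then have "poly_eval g n * poly_eval g d' = poly_eval g n' * poly_eval g d"
    by (metis poly_eval_mult)
  with 1 2 show ?thesis by (simp add: frac_eq_eq)
qed

lemma evaluates_poly: "evaluates g (Fract p 1) (poly_eval g p)"
  unfolding evaluates_def by (intro exI[of _ p] exI[of _ 1]) simp

lemma evaluates_const: "evaluates g (const c) (const c)"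
  using evaluates_poly[of g "Poly_Mapping.single 0 c"] by (simp add: const_def poly_eval_single)

lemma evaluates_1: "evaluates g 1 1"
  using evaluates_const[of g 1] by simp

lemma evaluates_X: "evaluates g (X v) (g v)"
  using evaluates_poly[of g "Poly_Mapping.single (Poly_Mapping.single v 1) 1"]
    mono_eval_single[of g v]
  by (simp add: X_def poly_eval_single)

lemma evaluates_add:
  assumes "evaluates g x y" "evaluates g x' y'"
  shows "evaluates g (x + x') (y + y')"
proof -
  from assms obtain n d n' d' where
    1: "d \<noteq> 0" "poly_eval g d \<noteq> 0" "x = Fract n d" "y = poly_eval g n / poly_eval g d" and
    2: "d' \<noteq> 0" "poly_eval g d' \<noteq> 0" "x' = Fract n' d'" "y' = poly_eval g n' / poly_eval g d'"
    unfolding evaluates_def by blast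
  then show ?thesis unfolding evaluates_def
    by (intro exI[of _ "n * d' + n' * d"] exI[of _ "d * d'"])
      (simp add: poly_eval_add poly_eval_mult add_frac_eq)
qed

lemma evaluates_mult:
  assumes "evaluates g x y" "evaluates g x' y'"
  shows "evaluates g (x * x') (y * y')"
proof -
  from assms obtain n d n' d' where
    1: "d \<noteq> 0" "poly_eval g d \<noteq> 0" "x = Fract n d" "y = poly_eval g n / poly_eval g d" and
    2: "d' \<noteq> 0" "poly_eval g d' \<noteq> 0" "x' = Fract n' d'" "y' = poly_eval g n' / poly_eval g d'"
    unfolding evaluates_def by blast
  then show ?thesis unfolding evaluates_def
    by (intro exI[of _ "n * n'"] exI[of _ "d * d'"]) (simp add: poly_eval_mult)
qed

lemma evaluates_inverse:
  assumes "evaluates g x y" "y \<noteq> 0"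
  shows "evaluates g (inverse x) (inverse y)"
proof -
  from assms obtain n d where
    1: "d \<noteq> 0" "poly_eval g d \<noteq> 0" "x = Fract n d" "y = poly_eval g n / poly_eval g d"
    unfolding evaluates_def by blast
  with assms(2) have "poly_eval g n \<noteq> 0" by auto
  with 1 show ?thesis unfolding evaluates_def
    by (intro exI[of _ d] exI[of _ n]) auto
qed

lemma evaluates_divide:
  assumes "evaluates g x y" "evaluates g x' y'" "y' \<noteq> 0"
  shows "evaluates g (x / x') (y / y')"
  unfolding divide_inverse using assms by (intro evaluates_mult evaluates_inverse)

lemma evaluates_power:
  assumes "evaluates g x y"
  shows "evaluates g (x ^ n) (y ^ n)"
  by (induction n) (simp_all add: evaluates_1 evaluates_mult assms)

lemma evaluates_poly_eval:
  assumes "\<And>v. evaluates g (g' v) (h v)"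
  shows "evaluates g (poly_eval g' p) (poly_eval h p)"
proof (induction p rule: poly_mapping_add_single_induct)
  case zero
  then show ?case using evaluates_const[of g 0] by simp
next
  case (add k c p)
  have "evaluates g (\<Prod>v\<in>A. g' v ^ Poly_Mapping.lookup k v) (\<Prod>v\<in>A. h v ^ Poly_Mapping.lookup k v)"
    for A
    by (induction A rule: infinite_finite_induct)
      (simp_all add: evaluates_1 evaluates_mult evaluates_power assms)
  then have "evaluates g (mono_eval g' k) (mono_eval h k)"
    by (simp add: mono_eval_def)
  with add show ?case
    by (simp add: poly_eval_add poly_eval_single evaluates_add evaluates_mult evaluates_const)
qed

text \<open>
  A substitution with a left inverse is algebraically independent: apply evaluation at \<open>g\<close> to
  \<open>p(g') = 0\<close> to get \<open>p = 0\<close>.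
\<close>

lemma poly_eval_inj:
  assumes "\<And>v. evaluates g (g' v) (X v)" "p \<noteq> 0"
  shows "poly_eval g' p \<noteq> 0"
proof
  assume "poly_eval g' p = 0"
  moreover have "evaluates g (poly_eval g' p) (poly_eval X p)"
    by (intro evaluates_poly_eval assms(1))
  ultimately have "evaluates g 0 (Fract p 1)"
    by (simp add: poly_eval_X)
  moreover have "evaluates g 0 0" using evaluates_const[of g 0] by simp
  ultimately have "Fract p 1 = 0" using evaluates_unique by blast
  with \<open>p \<noteq> 0\<close> show False by (simp add: Zero_fract_def eq_fract)
qed

subsection \<open>Homomorphisms over the complex numbers\<close>

definition C_hom :: "(ratfun \<Rightarrow> ratfun) \<Rightarrow> bool" where
  "C_hom h \<longleftrightarrow> (\<forall>x y. h (x + y) = h x + h y) \<and> (\<forall>x y. h (x * y) = h x * h y) \<and>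
     (\<forall>c. h (const c) = const c)"

lemma
  assumes "C_hom h"
  shows C_hom_add: "h (x + y) = h x + h y"
    and C_hom_mult: "h (x * y) = h x * h y"
    and C_hom_const: "h (const c) = const c"
    and C_hom_0: "h 0 = 0"
    and C_hom_1: "h 1 = 1"
    and C_hom_diff: "h (x - y) = h x - h y"
    and C_hom_inverse: "h (inverse x) = inverse (h x)"
    and C_hom_divide: "h (x / y) = h x / h y"
    and C_hom_power: "h (x ^ n) = h x ^ n"
    and C_hom_power_int: "h (x powi k) = h x powi k"
    and C_hom_eq_0_iff: "h x = 0 \<longleftrightarrow> x = 0"
proof -
  show add: "h (x + y) = h x + h y" and mult: "h (x * y) = h x * h y"
    and const: "h (const c) = const c" for x y c
    using assms by (auto simp: C_hom_def)
  show 0: "h 0 = 0" and 1: "h 1 = 1"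
    using const[of 0] const[of 1] by simp_all
  have uminus: "h (- x) = - h x" for x
    by (metis 0 add add.right_inverse add_eq_0_iff)
  show "h (x - y) = h x - h y"
    by (metis add uminus diff_conv_add_uminus)
  show inv: "h (inverse x) = inverse (h x)" for x
    by (metis 0 1 mult inverse_unique inverse_zero right_inverse)
  show "h (x / y) = h x / h y"
    by (simp add: divide_inverse mult inv)
  show power: "h (x ^ n) = h x ^ n" for x n
    by (induction n) (simp_all add: 1 mult)
  show "h (x powi k) = h x powi k"
    by (simp add: power_int_def power inv)
  show "h x = 0 \<longleftrightarrow> x = 0"
    by (metis 0 1 mult mult_zero_left right_inverse zero_neq_one)
qed

text \<open>Reduces every relation between compositions of transformations to a comparison on the
  ten variables.\<close>

lemma C_hom_ext:
  assumes "C_hom h" "C_hom h'" "\<And>v. h (X v) = h' (X v)"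
  shows "h = h'"
proof
  fix x :: ratfun
  have *: "h (mono_eval X k) = poly_eval (\<lambda>v. h (X v)) (Poly_Mapping.single k 1)" if "C_hom h" for h k
  proof -
    have "h (\<Prod>v\<in>A. X v ^ Poly_Mapping.lookup k v) = (\<Prod>v\<in>A. h (X v) ^ Poly_Mapping.lookup k v)" for A
      by (induction A rule: infinite_finite_induct)
        (simp_all add: C_hom_1 C_hom_mult C_hom_power that)
    then show ?thesis by (simp add: poly_eval_single mono_eval_def)
  qed
  have **: "h (Fract p 1) = h' (Fract p 1)" for p
  proof -
    have "h (poly_eval X p) = h' (poly_eval X p)"
      by (induction p rule: poly_mapping_add_single_induct)
        (simp_all add: poly_eval_add poly_eval_single C_hom_0 C_hom_add C_hom_mult C_hom_const
          * assms(1,2) assms(3))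
    then show ?thesis by (simp add: poly_eval_X)
  qed
  obtain n d where "x = Fract n d" by (cases x)
  then have "x = Fract n 1 / Fract d 1" by simp
  then show "h x = h' x" by (simp only: C_hom_divide assms(1,2) **)
qed

lemma C_hom_comp: "C_hom h \<Longrightarrow> C_hom h' \<Longrightarrow> C_hom (h \<circ> h')"
  by (simp add: C_hom_def)

lemma C_hom_id: "C_hom id" "C_hom (\<lambda>x. x)"
  by (simp_all add: C_hom_def)

lemma C_hom_exists:
  assumes "\<And>p. p \<noteq> 0 \<Longrightarrow> poly_eval g p \<noteq> 0"
  obtains h where "C_hom h" "\<And>v. h (X v) = g v" "\<And>x. evaluates g x (h x)"
proof -
  have "\<exists>y. evaluates g x y" for x
  proof -
    obtain n d where "x = Fract n d" "d \<noteq> 0" by (cases x)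
    then show ?thesis unfolding evaluates_def using assms by blast
  qed
  then obtain h where h: "\<And>x. evaluates g x (h x)" by metis
  have "C_hom h"
    unfolding C_hom_def
    using evaluates_unique[OF h] evaluates_add[OF h h] evaluates_mult[OF h h] evaluates_const
    by blast
  moreover have "h (X v) = g v" for v
    using evaluates_unique[OF h] evaluates_X by blast
  ultimately show ?thesis using h that by blast
qed

text \<open>Each hypothesis makes one of the two substitutions algebraically independent, so both
  extend to homomorphisms. These are mutually inverse on variables, hence everywhere, and uniqueness
  settles the definite description. Involutions use \<open>g' = g\<close>.\<close>

lemma automorphism_withI:
  assumes g: "\<And>v. evaluates g (g' v) (X v)" and g': "\<And>v. evaluates g' (g v) (X v)"
  shows "C_automorphism (automorphism_with g)" "automorphism_with g (X v) = g v"
proof -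
  obtain h where h: "C_hom h" "\<And>v. h (X v) = g v" "\<And>x. evaluates g x (h x)"
    using C_hom_exists poly_eval_inj[OF g'] by metis
  obtain h' where h': "C_hom h'" "\<And>v. h' (X v) = g' v" "\<And>x. evaluates g' x (h' x)"
    using C_hom_exists poly_eval_inj[OF g] by metis
  have "h \<circ> h' = id"
    using evaluates_unique[OF h(3)] g
    by (intro C_hom_ext C_hom_comp h(1) h'(1) C_hom_id) (auto simp: h'(2))
  moreover have "h' \<circ> h = id"
    using evaluates_unique[OF h'(3)] g'
    by (intro C_hom_ext C_hom_comp h(1) h'(1) C_hom_id) (auto simp: h(2))
  ultimately have "bij h" by (metis o_bij)
  with h have "C_automorphism h \<and> (\<forall>v. h (X v) = g v)"
    by (auto simp: C_automorphism_def C_hom_def)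
  moreover have "k = h" if "C_automorphism k \<and> (\<forall>v. k (X v) = g v)" for k
    using that h(1,2) by (intro C_hom_ext) (auto simp: C_automorphism_def C_hom_def)
  ultimately have "C_automorphism (automorphism_with g) \<and> (\<forall>v. automorphism_with g (X v) = g v)"
    unfolding automorphism_with_def by (rule theI)
  then show "C_automorphism (automorphism_with g)" "automorphism_with g (X v) = g v" by auto
qed

subsection \<open>The generators\<close>

lemma evaluates_nonzero: "evaluates g x y \<Longrightarrow> y \<noteq> 0 \<Longrightarrow> x \<noteq> 0"
  using evaluates_unique evaluates_const[of g 0] by fastforce

lemma const_of_nat: "const (of_nat n) = of_nat n"
  by (induction n) simp_all

text \<open>Characteristic zero makes the values 2 and 3 of \<open>s_form\<close> and
  \<open>w0_form\<close> at the all-ones point nonzero, and separates the twelfth power of 2 from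
  1.\<close>

instance fract :: ("{idom, ring_char_0}") field_char_0
proof
  show "inj (of_nat :: nat \<Rightarrow> 'a fract)"
    by (rule injI) (simp add: of_nat_fract eq_fract)
qed

lemma X_nonzero [simp]: "X v \<noteq> 0"
  using evaluates_nonzero[OF evaluates_X[of "\<lambda>_. 1"]] by simp

section \<open>Index arithmetic modulo 3 and enumeration of the variables\<close>

lemma mod3_indices:
  fixes i j k :: 3
  assumes "j = i + 1" "k = i - 1"
  shows "i + 1 = j" "j + 1 = k" "k + 1 = i" "i - 1 = k" "j - 1 = i" "k - 1 = j"
    "i \<noteq> j" "j \<noteq> i" "i \<noteq> k" "k \<noteq> i" "j \<noteq> k" "k \<noteq> j"
proof -
  have "(3 :: 3) = 0" by simp
  then have e: "i + 1 + 1 = i - 1" by (simp add: algebra_simps)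
  show "i + 1 = j" "j + 1 = k" "k + 1 = i" "i - 1 = k" "j - 1 = i" "k - 1 = j"
    "i \<noteq> j" "j \<noteq> i" "i \<noteq> k" "k \<noteq> i" "j \<noteq> k" "k \<noteq> j"
    using assms e by (auto simp: algebra_simps)
qed

text \<open>Lets a fact proved for the triple \<open>i, j, k\<close> be reused for its cyclic
  rotations.\<close>

lemma mod3_rotate:
  fixes i j k :: 3
  assumes "j = i + 1" "k = i - 1"
  shows "k = j + 1" "i = j - 1" "i = k + 1" "j = k - 1"
  using mod3_indices[OF assms] by simp_all

lemma mod3_cases:
  fixes i j k l :: 3
  assumes "j = i + 1" "k = i - 1"
  shows "l = i \<or> l = j \<or> l = k"
proof -
  have "m = 0 \<or> m = 1 \<or> m = 2" for m :: 3
  proof (cases m)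
    case (of_int n)
    then have "n = 0 \<or> n = 1 \<or> n = 2" by auto
    with of_int show ?thesis by auto
  qed
  from this[of "l - i"] have "l = i \<or> l = i + 1 \<or> l = i + 1 + 1"
    by (auto simp: eq_diff_eq diff_eq_eq add.commute)
  then show ?thesis using mod3_indices[OF assms] by auto
qed

lemma Q_cyclic:
  assumes "j = i + 1" "k = i - 1"
  shows "Q = \<alpha> i * \<alpha> j * \<alpha> k"
proof -
  have "(i = 0 \<and> j = 1 \<and> k = 2) \<or> (i = 1 \<and> j = 2 \<and> k = 0) \<or> (i = 2 \<and> j = 0 \<and> k = 1)"
    using mod3_cases[of "1::3" 0 2 i] assms by auto
  then show ?thesis by (auto simp: Q_def)
qed

lemma var_forall3:
  assumes "j = i + 1" "k = i - 1"
  shows "(\<forall>v. P v) \<longleftrightarrow> P (Alpha i) \<and> P (Alpha j) \<and> P (Alpha k) \<and> P Gamma \<and>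
    P (Tau i) \<and> P (Tau j) \<and> P (Tau k) \<and> P (Taubar i) \<and> P (Taubar j) \<and> P (Taubar k)"
    (is "_ \<longleftrightarrow> ?R")
proof
  assume ?R
  show "\<forall>v. P v"
  proof
    fix v show "P v"
      using \<open>?R\<close> mod3_cases[OF assms] by (cases v) metis+
  qed
qed auto

text \<open>
  Cleared of fractional powers, \<open>s\<^sub>i\<close> sends both \<open>\<tau>\<^sub>i\<close> and its barred partner to an \<open>s_form\<close>, with
  \<open>x = \<tau>\<^sub>i\<^sub>+\<^sub>1 * \<tau>bar\<^sub>i\<^sub>-\<^sub>1\<close> and \<open>y = \<tau>bar\<^sub>i\<^sub>+\<^sub>1 * \<tau>\<^sub>i\<^sub>-\<^sub>1\<close>; \<open>w0\<close> sends the barred variables to a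
  \<open>w0_form\<close> with \<open>p = \<gamma>\<^sup>4\<close>. Keeping these shapes folded makes the composed transformations
  readable and leaves one polynomial identity per relation.
\<close>

definition s_form :: "'a::field \<Rightarrow> 'a \<Rightarrow> 'a \<Rightarrow> 'a \<Rightarrow> 'a" where
  "s_form p x y d = (p * x + y / p) / d"

definition w0_form :: "'a::field \<Rightarrow> 'a \<Rightarrow> 'a \<Rightarrow> 'a \<Rightarrow> 'a \<Rightarrow> 'a" where
  "w0_form p x y w d = (x / p + y + w * p) / d"

lemma evaluates_s_form:
  assumes "evaluates g p p'" "evaluates g x x'" "evaluates g y y'" "evaluates g d d'"
    "p' \<noteq> 0" "d' \<noteq> 0"
  shows "evaluates g (s_form p x y d) (s_form p' x' y' d')"
  unfolding s_form_def using assms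
  by (intro evaluates_divide evaluates_add evaluates_mult)

lemma evaluates_w0_form:
  assumes "evaluates g p p'" "evaluates g x x'" "evaluates g y y'" "evaluates g w w'" "evaluates g d d'"
    "p' \<noteq> 0" "d' \<noteq> 0"
  shows "evaluates g (w0_form p x y w d) (w0_form p' x' y' w' d')"
  unfolding w0_form_def using assms
  by (intro evaluates_divide evaluates_add evaluates_mult)

lemmas evaluates_intros = evaluates_1 evaluates_X evaluates_mult evaluates_divide evaluates_inverse
  evaluates_power evaluates_s_form evaluates_w0_form

lemma evaluates_eq: "evaluates g x y \<Longrightarrow> y = y' \<Longrightarrow> evaluates g x y'"
  by simp

lemma C_automorphism_imp_C_hom: "C_automorphism h \<Longrightarrow> C_hom h"
  by (simp add: C_automorphism_def C_hom_def)

context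
  fixes i j k :: 3
  assumes jk: "j = i + 1" "k = i - 1"
begin

text \<open>With \<open>p = u_half i\<close> one has \<open>f i / a i = y / (p ^ 2 * x)\<close>, so
  the two terms carry the factors \<open>p\<close> and \<open>1 / p\<close>. For the barred variable
  the same holds with \<open>p = inverse (v_half i)\<close> and \<open>a i * f i\<close>.\<close>

lemma s_tau_img:
  "u_half i * (1 + f i / a i) * (\<tau>v (i + 1) * \<tau>bar (i - 1) / \<tau>bar i)
     = s_form (\<alpha> i ^ 2 / (\<alpha> j * \<alpha> k * \<gamma> ^ 2)) (\<tau>v j * \<tau>bar k) (\<tau>bar j * \<tau>v k) (\<tau>bar i)"
  unfolding u_half_def f_def a_def mod3_indices[OF jk] s_form_def Q_cyclic[OF jk]
  by (simp add: divide_simps) (simp add: algebra_simps power_def)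

lemma s_taubar_img:
  "inverse (v_half i) * (1 + a i * f i) * (\<tau>v (i + 1) * \<tau>bar (i - 1) / \<tau>v i)
     = s_form (inverse (\<alpha> i ^ 4 * \<alpha> j * \<alpha> k * \<gamma> ^ 2)) (\<tau>v j * \<tau>bar k) (\<tau>bar j * \<tau>v k) (\<tau>v i)"
  unfolding v_half_def f_def a_def mod3_indices[OF jk] s_form_def Q_cyclic[OF jk]
  by (simp add: divide_simps) (simp add: algebra_simps power_def)

lemma w0_taubar_img:
  "(\<alpha> (i + 1) / \<alpha> (i - 1)) ^ 2 * u (i - 1)
       * (1 + f (i - 1) / a (i - 1) + f (i - 1) * f (i + 1) / (a (i - 1) * a (i + 1)))
       * (\<tau>v i * \<tau>v (i - 1) / \<tau>bar (i - 1))
     = w0_form (\<gamma> ^ 4) (\<alpha> k ^ 2 / \<alpha> i ^ 2 * \<tau>v i * \<tau>v k * \<tau>bar j)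
         (\<alpha> j ^ 2 / \<alpha> k ^ 2 * \<tau>v j * \<tau>v k * \<tau>bar i)
         (\<alpha> i ^ 2 / \<alpha> j ^ 2 * \<tau>v i * \<tau>v j * \<tau>bar k) (\<tau>bar j * \<tau>bar k)"
  unfolding u_def f_def a_def mod3_indices[OF jk] w0_form_def Q_cyclic[OF jk]
  by (simp add: divide_simps) (simp add: algebra_simps power_def)

end

text \<open>
  All expressions below have positive coefficients, so they are nonzero because they do not
  vanish when every variable is set to 1.
\<close>

lemma evaluates_one_mult: "evaluates g x 1 \<Longrightarrow> evaluates g y 1 \<Longrightarrow> evaluates g (x * y) 1"
  using evaluates_mult by fastforce
lemma evaluates_one_divide: "evaluates g x 1 \<Longrightarrow> evaluates g y 1 \<Longrightarrow> evaluates g (x / y) 1"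
  using evaluates_divide by fastforce
lemma evaluates_one_inverse: "evaluates g x 1 \<Longrightarrow> evaluates g (inverse x) 1"
  using evaluates_inverse by fastforce
lemma evaluates_one_power: "evaluates g x 1 \<Longrightarrow> evaluates g (x ^ n) 1"
  using evaluates_power by fastforce
lemma evaluates_one_X: "evaluates (\<lambda>_. 1) (X v) 1"
  using evaluates_X by fastforce

lemmas evaluates_one_intros = evaluates_one_mult evaluates_one_divide evaluates_one_inverse
  evaluates_one_power evaluates_one_X

lemma s_form_nonzero:
  assumes "evaluates (\<lambda>_. 1) p 1" "evaluates (\<lambda>_. 1) x 1" "evaluates (\<lambda>_. 1) y 1"
    "evaluates (\<lambda>_. 1) d 1"
  shows "s_form p x y d \<noteq> 0"
  using evaluates_nonzero[OF evaluates_s_form[OF assms]] by (simp add: s_form_def)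

lemma w0_form_nonzero:
  assumes "evaluates (\<lambda>_. 1) p 1" "evaluates (\<lambda>_. 1) x 1" "evaluates (\<lambda>_. 1) y 1"
    "evaluates (\<lambda>_. 1) w 1" "evaluates (\<lambda>_. 1) d 1"
  shows "w0_form p x y w d \<noteq> 0"
  using evaluates_nonzero[OF evaluates_w0_form[OF assms]] by (simp add: w0_form_def)

text \<open>As a function of \<open>d\<close>, \<open>s_form\<close> is a constant divided by
  \<open>d\<close>, hence an involution.\<close>

lemma s_form_s_form: "p = p' \<Longrightarrow> s_form p' x y d \<noteq> 0 \<Longrightarrow> s_form p x y (s_form p' x y d) = d"
  by (auto simp: s_form_def field_simps)

text \<open>
  In the coordinates \<open>x\<^sub>i = (\<alpha>\<^sub>i\<^sub>+\<^sub>1 / \<alpha>\<^sub>i\<^sub>-\<^sub>1)\<^sup>2 * \<tau>bar\<^sub>i / \<tau>\<^sub>i\<close> the parameters disappear from \<open>w0\<close>, which becomes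
  \<open>x\<^sub>i \<mapsto> (x\<^sub>i\<^sub>+\<^sub>1 / p + x\<^sub>i + p * x\<^sub>i\<^sub>-\<^sub>1) / (x\<^sub>i\<^sub>+\<^sub>1 * x\<^sub>i\<^sub>-\<^sub>1)\<close> and \<open>p \<mapsto> 1 / p\<close>.
\<close>

lemma w0_involution_identity:
  fixes p x y w :: "'a :: field"
  assumes "p \<noteq> 0" "x \<noteq> 0" "y \<noteq> 0" "w \<noteq> 0"
  shows "(w / p + y + x * p) / (w * x) * p + (y / p + x + w * p) / (y * w) + (x / p + w + y * p) / (x * y) / p
    = x * ((w / p + y + x * p) / (w * x)) * ((x / p + w + y * p) / (x * y))"
  using assms by (simp add: divide_simps) (simp add: algebra_simps)

lemma w0_form_scale:
  fixes ai aj ak :: "'a :: field"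
  assumes "ai \<noteq> 0" "aj \<noteq> 0" "ak \<noteq> 0" "ti \<noteq> 0" "tj \<noteq> 0" "tk \<noteq> 0" "bj \<noteq> 0" "bk \<noteq> 0"
  shows "w0_form p (ak ^ 2 / ai ^ 2 * ti * tk * bj) (aj ^ 2 / ak ^ 2 * tj * tk * bi)
      (ai ^ 2 / aj ^ 2 * ti * tj * bk) (bj * bk) =
    ti * (ak / aj) ^ 2 * ((ak ^ 2 / ai ^ 2 * bj / tj) / p + aj ^ 2 / ak ^ 2 * bi / ti
      + (ai ^ 2 / aj ^ 2 * bk / tk) * p) / ((ak ^ 2 / ai ^ 2 * bj / tj) * (ai ^ 2 / aj ^ 2 * bk / tk))"
\<comment> \<open>At \<open>p = 0\<close> the outer terms vanish on both sides because
  \<open>x / 0 = 0\<close>; \<open>p\<close> can be cleared from denominators only in the other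
  case.\<close>
proof (cases "p = 0")
  case True
  with assms show ?thesis unfolding w0_form_def
    by (simp add: divide_simps)
next
  case False
  with assms show ?thesis unfolding w0_form_def
    by (simp add: divide_simps) (simp add: algebra_simps power2_eq_square)
qed

text \<open>The second application sees the images of the coordinates with \<open>p\<close>
  inverted, so \<open>w0_involution_identity\<close> returns the original coordinate; the factor
  \<open>ti * (ak / aj) ^ 2\<close> turns it back into \<open>bi\<close>.\<close>

lemma w0_form_invol:
  fixes ai aj ak c ti tj tk bi bj bk :: "'a :: field"
  defines "Bi \<equiv> w0_form (c ^ 4) (ak ^ 2 / ai ^ 2 * ti * tk * bj) (aj ^ 2 / ak ^ 2 * tj * tk * bi)
      (ai ^ 2 / aj ^ 2 * ti * tj * bk) (bj * bk)"
    and "Bj \<equiv> w0_form (c ^ 4) (ai ^ 2 / aj ^ 2 * tj * ti * bk) (ak ^ 2 / ai ^ 2 * tk * ti * bj)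
      (aj ^ 2 / ak ^ 2 * tj * tk * bi) (bk * bi)"
    and "Bk \<equiv> w0_form (c ^ 4) (aj ^ 2 / ak ^ 2 * tk * tj * bi) (ai ^ 2 / aj ^ 2 * ti * tj * bk)
      (ak ^ 2 / ai ^ 2 * tk * ti * bj) (bi * bj)"
  assumes B: "Bi \<noteq> 0" "Bj \<noteq> 0" "Bk \<noteq> 0" and
    nz: "ai \<noteq> 0" "aj \<noteq> 0" "ak \<noteq> 0" "c \<noteq> 0" "ti \<noteq> 0" "tj \<noteq> 0" "tk \<noteq> 0" "bi \<noteq> 0" "bj \<noteq> 0" "bk \<noteq> 0"
  shows "w0_form (inverse c ^ 4) (ak ^ 2 / ai ^ 2 * ti * tk * Bj) (aj ^ 2 / ak ^ 2 * tj * tk * Bi)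
      (ai ^ 2 / aj ^ 2 * ti * tj * Bk) (Bj * Bk) = bi"
proof -
  define x y w p where "x = aj ^ 2 / ak ^ 2 * bi / ti" and "y = ak ^ 2 / ai ^ 2 * bj / tj"
    and "w = ai ^ 2 / aj ^ 2 * bk / tk" and "p = c ^ 4"
  have xyw: "x \<noteq> 0" "y \<noteq> 0" "w \<noteq> 0" "p \<noteq> 0"
    using nz by (auto simp: x_def y_def w_def p_def)
  have X: "aj ^ 2 / ak ^ 2 * Bi / ti = (y / p + x + w * p) / (y * w)"
    "ak ^ 2 / ai ^ 2 * Bj / tj = (w / p + y + x * p) / (w * x)"
    "ai ^ 2 / aj ^ 2 * Bk / tk = (x / p + w + y * p) / (x * y)"
    unfolding Bi_def Bj_def Bk_def x_def y_def w_def p_def using nz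
    by (subst w0_form_scale; simp add: power_divide)+
  have *: "w0_form (inverse c ^ 4) (ak ^ 2 / ai ^ 2 * ti * tk * Bj) (aj ^ 2 / ak ^ 2 * tj * tk * Bi)
      (ai ^ 2 / aj ^ 2 * ti * tj * Bk) (Bj * Bk) =
      ti * (ak / aj) ^ 2 * ((w / p + y + x * p) / (w * x) / inverse c ^ 4 + (y / p + x + w * p) / (y * w)
        + (x / p + w + y * p) / (x * y) * inverse c ^ 4) /
        ((w / p + y + x * p) / (w * x) * ((x / p + w + y * p) / (x * y)))"
    using nz B by (subst w0_form_scale) (simp_all only: X not_False_eq_True)
  have nz': "(w / p + y + x * p) / (w * x) \<noteq> 0" "(x / p + w + y * p) / (x * y) \<noteq> 0"
    unfolding X[symmetric] using nz B by auto
  have "(w / p + y + x * p) / (w * x) / inverse c ^ 4 + (y / p + x + w * p) / (y * w)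
        + (x / p + w + y * p) / (x * y) * inverse c ^ 4
     = x * ((w / p + y + x * p) / (w * x)) * ((x / p + w + y * p) / (x * y))"
    using w0_involution_identity[of p x y w] xyw by (simp add: p_def divide_inverse power_inverse)
  then show ?thesis
    unfolding * using nz nz' by (simp add: x_def power_divide)
qed

section \<open>The prescribed values define automorphisms\<close>

context
  fixes i j k :: 3
  assumes jk: "j = i + 1" "k = i - 1"
begin

lemma s_props:
  shows "C_automorphism (s i)"
    and "s i (\<alpha> i) = inverse (\<alpha> i)" "s i (\<alpha> j) = \<alpha> i * \<alpha> j" "s i (\<alpha> k) = \<alpha> i * \<alpha> k" "s i \<gamma> = \<gamma>"
    and "s i (\<tau>v i) = s_form (\<alpha> i ^ 2 / (\<alpha> j * \<alpha> k * \<gamma> ^ 2)) (\<tau>v j * \<tau>bar k) (\<tau>bar j * \<tau>v k) (\<tau>bar i)"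
    and "s i (\<tau>v j) = \<tau>v j" "s i (\<tau>v k) = \<tau>v k"
    and "s i (\<tau>bar i) = s_form (inverse (\<alpha> i ^ 4 * \<alpha> j * \<alpha> k * \<gamma> ^ 2)) (\<tau>v j * \<tau>bar k) (\<tau>bar j * \<tau>v k) (\<tau>v i)"
    and "s i (\<tau>bar j) = \<tau>bar j" "s i (\<tau>bar k) = \<tau>bar k"
proof -
  define g where "g = (\<lambda>v. case v of
     Alpha l \<Rightarrow> if l = i then inverse (\<alpha> i) else \<alpha> i * \<alpha> l
   | Gamma \<Rightarrow> \<gamma>
   | Tau l \<Rightarrow> if l = i
       then u_half i * (1 + f i / a i) * (\<tau>v (i + 1) * \<tau>bar (i - 1) / \<tau>bar i)
       else \<tau>v l
   | Taubar l \<Rightarrow> if l = i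
       then inverse (v_half i) * (1 + a i * f i) * (\<tau>v (i + 1) * \<tau>bar (i - 1) / \<tau>v i)
       else \<tau>bar l)"
  have g: "g (Alpha i) = inverse (\<alpha> i)" "g (Alpha j) = \<alpha> i * \<alpha> j" "g (Alpha k) = \<alpha> i * \<alpha> k" "g Gamma = \<gamma>"
    "g (Tau i) = s_form (\<alpha> i ^ 2 / (\<alpha> j * \<alpha> k * \<gamma> ^ 2)) (\<tau>v j * \<tau>bar k) (\<tau>bar j * \<tau>v k) (\<tau>bar i)"
    "g (Tau j) = \<tau>v j" "g (Tau k) = \<tau>v k"
    "g (Taubar i) = s_form (inverse (\<alpha> i ^ 4 * \<alpha> j * \<alpha> k * \<gamma> ^ 2)) (\<tau>v j * \<tau>bar k) (\<tau>bar j * \<tau>v k) (\<tau>v i)"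
    "g (Taubar j) = \<tau>bar j" "g (Taubar k) = \<tau>bar k"
    unfolding g_def var.case s_tau_img[OF jk] s_taubar_img[OF jk]
    by (simp_all add: mod3_indices[OF jk])
  have s: "s i = automorphism_with g"
    by (simp add: s_def g_def)
  have "\<forall>v. g v \<noteq> 0"
    unfolding var_forall3[OF jk] g by (intro conjI s_form_nonzero evaluates_one_intros) simp_all
  then have nz: "g v \<noteq> 0" for v by blast
  have "\<forall>v. evaluates g (g v) (X v)"
    unfolding var_forall3[OF jk]
  proof (intro conjI)
    \<comment> \<open>After \<open>evaluates_eq\<close> the value is schematic: the introduction
      rules compute it, and only then is it compared with the variable.\<close>
    show "evaluates g (g (Alpha i)) (\<alpha> i)"
      by (rule evaluates_eq, subst g, (rule evaluates_intros | (simp add: nz; fail))+) (simp add: g)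
    show "evaluates g (g (Alpha j)) (\<alpha> j)"
      by (rule evaluates_eq, subst g, (rule evaluates_intros | (simp add: nz; fail))+) (simp add: g)
    show "evaluates g (g (Alpha k)) (\<alpha> k)"
      by (rule evaluates_eq, subst g, (rule evaluates_intros | (simp add: nz; fail))+) (simp add: g)
    \<comment> \<open>The substitution exchanges the coefficients of the two \<open>s_form\<close>s,
      so both nested forms have the same \<open>p\<close>.\<close>
    show "evaluates g (g (Tau i)) (\<tau>v i)"
      apply (rule evaluates_eq, subst g, (rule evaluates_intros | (simp add: nz; fail))+)
      apply (simp only: g, rule s_form_s_form)
      subgoal by (simp add: field_simps eval_nat_numeral)
      subgoal using nz[of "Tau i"] nz[of "Taubar i"] by (simp only: g not_False_eq_True)
      done
    show "evaluates g (g (Taubar i)) (\<tau>bar i)"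
      apply (rule evaluates_eq, subst g, (rule evaluates_intros | (simp add: nz; fail))+)
      apply (simp only: g, rule s_form_s_form)
      subgoal by (simp add: field_simps eval_nat_numeral)
      subgoal using nz[of "Tau i"] nz[of "Taubar i"] by (simp only: g not_False_eq_True)
      done
  qed (use evaluates_X[of g] g in metis)+
  note * = automorphism_withI[OF this[rule_format] this[rule_format], folded s, unfolded g]
  show "C_automorphism (s i)"
    and "s i (\<alpha> i) = inverse (\<alpha> i)" "s i (\<alpha> j) = \<alpha> i * \<alpha> j" "s i (\<alpha> k) = \<alpha> i * \<alpha> k" "s i \<gamma> = \<gamma>"
    and "s i (\<tau>v i) = s_form (\<alpha> i ^ 2 / (\<alpha> j * \<alpha> k * \<gamma> ^ 2)) (\<tau>v j * \<tau>bar k) (\<tau>bar j * \<tau>v k) (\<tau>bar i)"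
    and "s i (\<tau>v j) = \<tau>v j" "s i (\<tau>v k) = \<tau>v k"
    and "s i (\<tau>bar i) = s_form (inverse (\<alpha> i ^ 4 * \<alpha> j * \<alpha> k * \<gamma> ^ 2)) (\<tau>v j * \<tau>bar k) (\<tau>bar j * \<tau>v k) (\<tau>v i)"
    and "s i (\<tau>bar j) = \<tau>bar j" "s i (\<tau>bar k) = \<tau>bar k"
    by (simp_all add: * g)
qed

lemma w0_props:
  shows "C_automorphism w0" "w0 (\<alpha> l) = \<alpha> l" "w0 \<gamma> = inverse \<gamma>" "w0 (\<tau>v l) = \<tau>v l"
    and "w0 (\<tau>bar i) = w0_form (\<gamma> ^ 4) (\<alpha> k ^ 2 / \<alpha> i ^ 2 * \<tau>v i * \<tau>v k * \<tau>bar j)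
         (\<alpha> j ^ 2 / \<alpha> k ^ 2 * \<tau>v j * \<tau>v k * \<tau>bar i)
         (\<alpha> i ^ 2 / \<alpha> j ^ 2 * \<tau>v i * \<tau>v j * \<tau>bar k) (\<tau>bar j * \<tau>bar k)"
proof -
  define g where "g = (\<lambda>v. case v of
     Alpha i \<Rightarrow> \<alpha> i
   | Gamma \<Rightarrow> inverse \<gamma>
   | Tau i \<Rightarrow> \<tau>v i
   | Taubar i \<Rightarrow> (\<alpha> (i + 1) / \<alpha> (i - 1)) ^ 2 * u (i - 1)
       * (1 + f (i - 1) / a (i - 1) + f (i - 1) * f (i + 1) / (a (i - 1) * a (i + 1)))
       * (\<tau>v i * \<tau>v (i - 1) / \<tau>bar (i - 1)))"
  have w0: "w0 = automorphism_with g"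
    by (simp add: w0_def g_def)
  have g_bar: "g (Taubar i) = w0_form (\<gamma> ^ 4) (\<alpha> k ^ 2 / \<alpha> i ^ 2 * \<tau>v i * \<tau>v k * \<tau>bar j)
         (\<alpha> j ^ 2 / \<alpha> k ^ 2 * \<tau>v j * \<tau>v k * \<tau>bar i)
         (\<alpha> i ^ 2 / \<alpha> j ^ 2 * \<tau>v i * \<tau>v j * \<tau>bar k) (\<tau>bar j * \<tau>bar k)"
    if "j = i + 1" "k = i - 1" for i j k
    unfolding g_def var.case w0_taubar_img[OF that] ..
  note g = g_bar[OF jk] g_bar[OF mod3_rotate(1,2)[OF jk]] g_bar[OF mod3_rotate(3,4)[OF jk]]
  have g': "g (Alpha l) = \<alpha> l" "g Gamma = inverse \<gamma>" "g (Tau l) = \<tau>v l" for l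
    by (simp_all add: g_def)
  have "\<forall>v. g v \<noteq> 0"
    unfolding var_forall3[OF jk] g g' by (intro conjI w0_form_nonzero evaluates_one_intros) simp_all
  then have nz: "g v \<noteq> 0" for v by blast
  have bar: "evaluates g (g (Taubar i)) (\<tau>bar i)"
    if jk: "j = i + 1" "k = i - 1" for i j k
  proof -
    note g = g_bar[OF jk] g_bar[OF mod3_rotate(1,2)[OF jk]] g_bar[OF mod3_rotate(3,4)[OF jk]]
    show ?thesis
      apply (rule evaluates_eq, subst g(1), (rule evaluates_intros | (simp add: nz; fail))+)
      using nz[of "Taubar i"] nz[of "Taubar j"] nz[of "Taubar k"]
      unfolding g g'
      by (intro w0_form_invol X_nonzero)
  qed
  have "\<forall>v. evaluates g (g v) (X v)"
    unfolding var_forall3[OF jk]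
  proof (intro conjI)
    show "evaluates g (g (Taubar i)) (\<tau>bar i)" by (rule bar[OF jk])
    show "evaluates g (g (Taubar j)) (\<tau>bar j)" by (rule bar[OF mod3_rotate(1,2)[OF jk]])
    show "evaluates g (g (Taubar k)) (\<tau>bar k)" by (rule bar[OF mod3_rotate(3,4)[OF jk]])
    show "evaluates g (g Gamma) \<gamma>"
      by (rule evaluates_eq, subst g', (rule evaluates_intros | (simp add: nz; fail))+) (simp add: g')
  qed (use evaluates_X[of g] g' in metis)+
  note * = automorphism_withI[OF this[rule_format] this[rule_format], folded w0]
  show "C_automorphism w0" "w0 (\<alpha> l) = \<alpha> l" "w0 \<gamma> = inverse \<gamma>" "w0 (\<tau>v l) = \<tau>v l"
    and "w0 (\<tau>bar i) = w0_form (\<gamma> ^ 4) (\<alpha> k ^ 2 / \<alpha> i ^ 2 * \<tau>v i * \<tau>v k * \<tau>bar j)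
         (\<alpha> j ^ 2 / \<alpha> k ^ 2 * \<tau>v j * \<tau>v k * \<tau>bar i)
         (\<alpha> i ^ 2 / \<alpha> j ^ 2 * \<tau>v i * \<tau>v j * \<tau>bar k) (\<tau>bar j * \<tau>bar k)"
    by (simp_all only: * g g')
qed

end

lemma r_props: "C_automorphism r" "r (\<alpha> l) = \<alpha> l" "r \<gamma> = inverse Q * inverse \<gamma>"
  "r (\<tau>v l) = \<tau>bar l" "r (\<tau>bar l) = \<tau>v l"
proof -
  define g where "g = (\<lambda>v. case v of
     Alpha i \<Rightarrow> \<alpha> i
   | Gamma \<Rightarrow> inverse Q * inverse \<gamma>
   | Tau i \<Rightarrow> \<tau>bar i
   | Taubar i \<Rightarrow> \<tau>v i)"
  have r: "r = automorphism_with g"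
    by (simp add: r_def g_def)
  have g: "g (Alpha l) = \<alpha> l" "g Gamma = inverse (\<alpha> 0 * \<alpha> 1 * \<alpha> 2) * inverse \<gamma>"
    "g (Tau l) = \<tau>bar l" "g (Taubar l) = \<tau>v l" for l
    by (simp_all add: g_def Q_def)
  have "evaluates g (g v) (X v)" for v
  proof (cases v)
    case Gamma
    then show ?thesis
      by (simp only: g(2)) (rule evaluates_eq, (rule evaluates_intros | (simp add: g Q_def; fail))+,
        simp add: g divide_simps)
  qed (metis evaluates_X g)+
  note * = automorphism_withI[OF this this, folded r]
  show "C_automorphism r" "r (\<alpha> l) = \<alpha> l" "r \<gamma> = inverse Q * inverse \<gamma>"
  "r (\<tau>v l) = \<tau>bar l" "r (\<tau>bar l) = \<tau>v l"
    by (simp_all only: * g Q_def)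
qed

lemma \<pi>_props: "C_automorphism \<pi>" "\<pi> (\<alpha> l) = \<alpha> (l + 1)" "\<pi> \<gamma> = \<gamma>"
  "\<pi> (\<tau>v l) = \<tau>v (l + 1)" "\<pi> (\<tau>bar l) = \<tau>bar (l + 1)"
proof -
  define g where "g = (\<lambda>v. case v of
     Alpha i \<Rightarrow> \<alpha> (i + 1)
   | Gamma \<Rightarrow> \<gamma>
   | Tau i \<Rightarrow> \<tau>v (i + 1)
   | Taubar i \<Rightarrow> \<tau>bar (i + 1))"
  \<comment> \<open>The rotation has order three and is not its own inverse, so a separate inverse
    substitution is supplied.\<close>
  define g' where "g' = (\<lambda>v. case v of
     Alpha i \<Rightarrow> \<alpha> (i - 1)
   | Gamma \<Rightarrow> \<gamma>
   | Tau i \<Rightarrow> \<tau>v (i - 1)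
   | Taubar i \<Rightarrow> \<tau>bar (i - 1))"
  have \<pi>: "\<pi> = automorphism_with g"
    by (simp add: \<pi>_def g_def)
  have g: "g (Alpha l) = \<alpha> (l + 1)" "g Gamma = \<gamma>" "g (Tau l) = \<tau>v (l + 1)" "g (Taubar l) = \<tau>bar (l + 1)"
    "g' (Alpha l) = \<alpha> (l - 1)" "g' Gamma = \<gamma>" "g' (Tau l) = \<tau>v (l - 1)" "g' (Taubar l) = \<tau>bar (l - 1)"
    for l by (simp_all add: g_def g'_def)
  have "evaluates g (g' v) (X v)" "evaluates g' (g v) (X v)" for v
    by (cases v; metis evaluates_X g diff_add_cancel add_diff_cancel_right')+
  note * = automorphism_withI[OF this, folded \<pi>]
  show "C_automorphism \<pi>" "\<pi> (\<alpha> l) = \<alpha> (l + 1)" "\<pi> \<gamma> = \<gamma>"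
  "\<pi> (\<tau>v l) = \<tau>v (l + 1)" "\<pi> (\<tau>bar l) = \<tau>bar (l + 1)"
    by (simp_all only: * g)
qed

subsection \<open>Relations between the generators\<close>

text \<open>As \<open>w0\<close> fixes \<open>\<tau>v i\<close>, commutation with \<open>s i\<close>
  there means that \<open>s i (\<tau>v i)\<close> is invariant under \<open>w0\<close>. The
  denominator \<open>Bi\<close> is a sum, so the identity is checked after
  cross-multiplication.\<close>

lemma s_form_w0_form_tau:
  fixes ai aj ak c ti tj tk bi bj bk :: "'a :: field"
  defines "Bi \<equiv> w0_form (c ^ 4) (ak ^ 2 / ai ^ 2 * ti * tk * bj) (aj ^ 2 / ak ^ 2 * tj * tk * bi)
      (ai ^ 2 / aj ^ 2 * ti * tj * bk) (bj * bk)"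
    and "Bj \<equiv> w0_form (c ^ 4) (ai ^ 2 / aj ^ 2 * tj * ti * bk) (ak ^ 2 / ai ^ 2 * tk * ti * bj)
      (aj ^ 2 / ak ^ 2 * tj * tk * bi) (bk * bi)"
    and "Bk \<equiv> w0_form (c ^ 4) (aj ^ 2 / ak ^ 2 * tk * tj * bi) (ai ^ 2 / aj ^ 2 * ti * tj * bk)
      (ak ^ 2 / ai ^ 2 * tk * ti * bj) (bi * bj)"
  assumes B: "Bi \<noteq> 0" and
    nz: "ai \<noteq> 0" "aj \<noteq> 0" "ak \<noteq> 0" "c \<noteq> 0" "ti \<noteq> 0" "tj \<noteq> 0" "tk \<noteq> 0" "bi \<noteq> 0" "bj \<noteq> 0" "bk \<noteq> 0"
  shows "s_form (ai ^ 2 / (aj * ak * inverse c ^ 2)) (tj * Bk) (Bj * tk) Bi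
     = s_form (ai ^ 2 / (aj * ak * c ^ 2)) (tj * bk) (bj * tk) bi"
proof -
  have "bi * (ai ^ 2 / (aj * ak * inverse c ^ 2) * (tj * Bk) + Bj * tk / (ai ^ 2 / (aj * ak * inverse c ^ 2)))
    = (ai ^ 2 / (aj * ak * c ^ 2) * (tj * bk) + bj * tk / (ai ^ 2 / (aj * ak * c ^ 2))) * Bi"
    unfolding Bi_def Bj_def Bk_def w0_form_def using nz
    by (simp add: divide_simps) (simp add: algebra_simps eval_nat_numeral)
  then show ?thesis using B nz by (simp add: s_form_def frac_eq_eq mult.commute)
qed

lemma s_form_w0_form_taubar:
  fixes ai aj ak c ti tj tk bi bj bk :: "'a :: field"
  defines "Ti \<equiv> s_form (ai ^ 2 / (aj * ak * c ^ 2)) (tj * bk) (bj * tk) bi"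
    and "Si \<equiv> s_form (inverse (ai ^ 4 * aj * ak * c ^ 2)) (tj * bk) (bj * tk) ti"
    and "Bj \<equiv> w0_form (c ^ 4) (ai ^ 2 / aj ^ 2 * tj * ti * bk) (ak ^ 2 / ai ^ 2 * tk * ti * bj)
      (aj ^ 2 / ak ^ 2 * tj * tk * bi) (bk * bi)"
    and "Bk \<equiv> w0_form (c ^ 4) (aj ^ 2 / ak ^ 2 * tk * tj * bi) (ai ^ 2 / aj ^ 2 * ti * tj * bk)
      (ak ^ 2 / ai ^ 2 * tk * ti * bj) (bi * bj)"
  assumes
    nz: "ai \<noteq> 0" "aj \<noteq> 0" "ak \<noteq> 0" "c \<noteq> 0" "ti \<noteq> 0" "tj \<noteq> 0" "tk \<noteq> 0" "bi \<noteq> 0" "bj \<noteq> 0" "bk \<noteq> 0"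
  shows "s_form (inverse (ai ^ 4 * aj * ak * inverse c ^ 2)) (tj * Bk) (Bj * tk) ti
     = w0_form (c ^ 4) ((ai * ak) ^ 2 / inverse ai ^ 2 * Ti * tk * bj) ((ai * aj) ^ 2 / (ai * ak) ^ 2 * tj * tk * Si)
      (inverse ai ^ 2 / (ai * aj) ^ 2 * Ti * tj * bk) (bj * bk)"
  unfolding Bj_def Bk_def Ti_def Si_def w0_form_def s_form_def using nz
  by (simp add: divide_simps) (simp add: algebra_simps eval_nat_numeral)

text \<open>As \<open>s i\<close> fixes the barred variables at \<open>j\<close> and
  \<open>k\<close>, their \<open>w0\<close> images must be \<open>s i\<close>-invariant. The
  numerator picks up the factor \<open>Si / bi\<close>, exactly as the denominator does.\<close>

lemma s_form_w0_form_taubar_next: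
  fixes ai aj ak c ti tj tk bi bj bk :: "'a :: field"
  defines "Ti \<equiv> s_form (ai ^ 2 / (aj * ak * c ^ 2)) (tj * bk) (bj * tk) bi"
    and "Si \<equiv> s_form (inverse (ai ^ 4 * aj * ak * c ^ 2)) (tj * bk) (bj * tk) ti"
  assumes Si: "Si \<noteq> 0" and
    nz: "ai \<noteq> 0" "aj \<noteq> 0" "ak \<noteq> 0" "c \<noteq> 0" "ti \<noteq> 0" "tj \<noteq> 0" "tk \<noteq> 0" "bi \<noteq> 0" "bj \<noteq> 0" "bk \<noteq> 0"
  shows "w0_form (c ^ 4) (inverse ai ^ 2 / (ai * aj) ^ 2 * tj * Ti * bk) ((ai * ak) ^ 2 / inverse ai ^ 2 * tk * Ti * bj)
      ((ai * aj) ^ 2 / (ai * ak) ^ 2 * tj * tk * Si) (bk * Si)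
    = w0_form (c ^ 4) (ai ^ 2 / aj ^ 2 * tj * ti * bk) (ak ^ 2 / ai ^ 2 * tk * ti * bj)
      (aj ^ 2 / ak ^ 2 * tj * tk * bi) (bk * bi)"
   "w0_form (c ^ 4) ((ai * aj) ^ 2 / (ai * ak) ^ 2 * tk * tj * Si) (inverse ai ^ 2 / (ai * aj) ^ 2 * Ti * tj * bk)
      ((ai * ak) ^ 2 / inverse ai ^ 2 * tk * Ti * bj) (Si * bj)
    = w0_form (c ^ 4) (aj ^ 2 / ak ^ 2 * tk * tj * bi) (ai ^ 2 / aj ^ 2 * ti * tj * bk)
      (ak ^ 2 / ai ^ 2 * tk * ti * bj) (bi * bj)"
proof -
  have "(inverse ai ^ 2 / (ai * aj) ^ 2 * tj * Ti * bk) / c ^ 4 + ((ai * ak) ^ 2 / inverse ai ^ 2 * tk * Ti * bj)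
      + ((ai * aj) ^ 2 / (ai * ak) ^ 2 * tj * tk * Si) * c ^ 4 =
    Si / bi * ((ai ^ 2 / aj ^ 2 * tj * ti * bk) / c ^ 4 + (ak ^ 2 / ai ^ 2 * tk * ti * bj) +
      (aj ^ 2 / ak ^ 2 * tj * tk * bi) * c ^ 4)"
    unfolding Ti_def Si_def s_form_def using nz
    by (simp add: divide_simps) (simp add: algebra_simps eval_nat_numeral)
  then show "w0_form (c ^ 4) (inverse ai ^ 2 / (ai * aj) ^ 2 * tj * Ti * bk) ((ai * ak) ^ 2 / inverse ai ^ 2 * tk * Ti * bj)
      ((ai * aj) ^ 2 / (ai * ak) ^ 2 * tj * tk * Si) (bk * Si)
    = w0_form (c ^ 4) (ai ^ 2 / aj ^ 2 * tj * ti * bk) (ak ^ 2 / ai ^ 2 * tk * ti * bj)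
      (aj ^ 2 / ak ^ 2 * tj * tk * bi) (bk * bi)"
    unfolding w0_form_def using nz Si by (simp add: mult.commute)
  have "((ai * aj) ^ 2 / (ai * ak) ^ 2 * tk * tj * Si) / c ^ 4 + (inverse ai ^ 2 / (ai * aj) ^ 2 * Ti * tj * bk)
      + ((ai * ak) ^ 2 / inverse ai ^ 2 * tk * Ti * bj) * c ^ 4 =
    Si / bi * ((aj ^ 2 / ak ^ 2 * tk * tj * bi) / c ^ 4 + (ai ^ 2 / aj ^ 2 * ti * tj * bk) +
      (ak ^ 2 / ai ^ 2 * tk * ti * bj) * c ^ 4)"
    unfolding Ti_def Si_def s_form_def using nz
    by (simp add: divide_simps) (simp add: algebra_simps eval_nat_numeral)
  then show "w0_form (c ^ 4) ((ai * aj) ^ 2 / (ai * ak) ^ 2 * tk * tj * Si) (inverse ai ^ 2 / (ai * aj) ^ 2 * Ti * tj * bk)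
      ((ai * ak) ^ 2 / inverse ai ^ 2 * tk * Ti * bj) (Si * bj)
    = w0_form (c ^ 4) (aj ^ 2 / ak ^ 2 * tk * tj * bi) (ai ^ 2 / aj ^ 2 * ti * tj * bk)
      (ak ^ 2 / ai ^ 2 * tk * ti * bj) (bi * bj)"
    unfolding w0_form_def using nz Si by (simp add: mult.commute)
qed

text \<open>
  On \<open>\<tau>\<^sub>i\<close>, fixed by \<open>s\<^sub>j\<close>, the braid relation says that \<open>s\<^sub>j s\<^sub>i \<tau>\<^sub>i\<close> is invariant under \<open>s\<^sub>i\<close>; similarly for the
  other three variables that \<open>s\<^sub>i\<close> or \<open>s\<^sub>j\<close> moves. \<open>Tji\<close> and \<open>Bji\<close> are the values of \<open>s\<^sub>j s\<^sub>i\<close>, \<open>Tij\<close> and \<open>Bij\<close> those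
  of \<open>s\<^sub>i s\<^sub>j\<close>.
\<close>

lemma
  fixes ai aj ak c ti tj tk bi bj bk :: "'a :: field"
  defines "Ti \<equiv> s_form (ai ^ 2 / (aj * ak * c ^ 2)) (tj * bk) (bj * tk) bi"
    and "Bi \<equiv> s_form (inverse (ai ^ 4 * aj * ak * c ^ 2)) (tj * bk) (bj * tk) ti"
    and "Tj \<equiv> s_form (aj ^ 2 / (ak * ai * c ^ 2)) (tk * bi) (bk * ti) bj"
    and "Bj \<equiv> s_form (inverse (aj ^ 4 * ak * ai * c ^ 2)) (tk * bi) (bk * ti) tj"
  defines "Tij \<equiv> s_form ((ai * aj) ^ 2 / (ai * ak * inverse ai * c ^ 2)) (tk * Bi) (bk * Ti) bj"
    and "Bij \<equiv> s_form (inverse ((ai * aj) ^ 4 * (ai * ak) * inverse ai * c ^ 2)) (tk * Bi) (bk * Ti) tj"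
    and "Tji \<equiv> s_form ((aj * ai) ^ 2 / (inverse aj * (aj * ak) * c ^ 2)) (Tj * bk) (Bj * tk) bi"
    and "Bji \<equiv> s_form (inverse ((aj * ai) ^ 4 * inverse aj * (aj * ak) * c ^ 2)) (Tj * bk) (Bj * tk) ti"
  assumes nz: "Ti \<noteq> 0" "Bi \<noteq> 0" "Tj \<noteq> 0" "Bj \<noteq> 0"
    "ai \<noteq> 0" "aj \<noteq> 0" "ak \<noteq> 0" "c \<noteq> 0" "ti \<noteq> 0" "tj \<noteq> 0" "tk \<noteq> 0" "bi \<noteq> 0" "bj \<noteq> 0" "bk \<noteq> 0"
  shows braid_tau: "s_form ((ai * aj * inverse ai) ^ 2 / (inverse (ai * aj) * (ai * aj * (ai * ak)) * c ^ 2))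
      (Tij * bk) (Bij * tk) Bi = Tji"
    and braid_taubar: "s_form (inverse ((ai * aj * inverse ai) ^ 4 * inverse (ai * aj) * (ai * aj * (ai * ak)) * c ^ 2))
      (Tij * bk) (Bij * tk) Ti = Bji"
    and braid_tau_next: "Tij = s_form ((aj * ai * inverse aj) ^ 2 / (aj * ai * (aj * ak) * inverse (aj * ai) * c ^ 2))
      (tk * Bji) (bk * Tji) Bj"
    and braid_taubar_next: "Bij = s_form (inverse ((aj * ai * inverse aj) ^ 4 * (aj * ai * (aj * ak)) * inverse (aj * ai) * c ^ 2))
      (tk * Bji) (bk * Tji) Tj"
proof -
  let ?p = "aj ^ 2 / (ai * ak * c ^ 2)" and ?q = "inverse (aj ^ 4 * ai * ak * c ^ 2)"
  let ?p' = "ai ^ 2 / (aj * ak * c ^ 2)" and ?q' = "inverse (ai ^ 4 * aj * ak * c ^ 2)"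
  \<comment> \<open>Since \<open>s i \<circ> s j\<close> sends \<open>\<alpha> i\<close> to
    \<open>\<alpha> j\<close>, the nested parameters collapse to the coefficients of
    \<open>s j\<close> (\<open>?p\<close>, \<open>?q\<close>) and, with \<open>i\<close> and
    \<open>j\<close> exchanged, to those of \<open>s i\<close>.\<close>
  have p: "(ai * aj * inverse ai) ^ 2 / (inverse (ai * aj) * (ai * aj * (ai * ak)) * c ^ 2) = ?p"
     "inverse ((ai * aj * inverse ai) ^ 4 * inverse (ai * aj) * (ai * aj * (ai * ak)) * c ^ 2) = ?q"
     "(aj * ai * inverse aj) ^ 2 / (aj * ai * (aj * ak) * inverse (aj * ai) * c ^ 2) = ?p'"
     "inverse ((aj * ai * inverse aj) ^ 4 * (aj * ai * (aj * ak)) * inverse (aj * ai) * c ^ 2) = ?q'"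
    using nz by (simp_all add: field_simps)
  note d = Ti_def Bi_def Tj_def Bj_def
  have "bi * (?p * (Tij * bk) + Bij * tk / ?p) =
     ((aj * ai) ^ 2 / (inverse aj * (aj * ak) * c ^ 2) * (Tj * bk) + (Bj * tk) / ((aj * ai) ^ 2 / (inverse aj * (aj * ak) * c ^ 2))) * Bi"
    unfolding Tij_def Bij_def d s_form_def using nz(5-)
    by (simp add: divide_simps) (simp add: algebra_simps eval_nat_numeral)
  then show "s_form ((ai * aj * inverse ai) ^ 2 / (inverse (ai * aj) * (ai * aj * (ai * ak)) * c ^ 2))
      (Tij * bk) (Bij * tk) Bi = Tji"
    unfolding p Tji_def using nz by (simp add: s_form_def frac_eq_eq mult.commute)
  have "ti * (?q * (Tij * bk) + Bij * tk / ?q) =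
     (inverse ((aj * ai) ^ 4 * inverse aj * (aj * ak) * c ^ 2) * (Tj * bk) + (Bj * tk) / inverse ((aj * ai) ^ 4 * inverse aj * (aj * ak) * c ^ 2)) * Ti"
    unfolding Tij_def Bij_def d s_form_def using nz(5-)
    by (simp add: divide_simps) (simp add: algebra_simps eval_nat_numeral)
  then show "s_form (inverse ((ai * aj * inverse ai) ^ 4 * inverse (ai * aj) * (ai * aj * (ai * ak)) * c ^ 2))
      (Tij * bk) (Bij * tk) Ti = Bji"
    unfolding p Bji_def using nz by (simp add: s_form_def frac_eq_eq mult.commute)
  have "((ai * aj) ^ 2 / (ai * ak * inverse ai * c ^ 2) * (tk * Bi) + (bk * Ti) / ((ai * aj) ^ 2 / (ai * ak * inverse ai * c ^ 2))) * Bj =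
     bj * (?p' * (tk * Bji) + bk * Tji / ?p')"
    unfolding Tji_def Bji_def d s_form_def using nz(5-)
    by (simp add: divide_simps) (simp add: algebra_simps eval_nat_numeral)
  then show "Tij = s_form ((aj * ai * inverse aj) ^ 2 / (aj * ai * (aj * ak) * inverse (aj * ai) * c ^ 2))
      (tk * Bji) (bk * Tji) Bj"
    unfolding p Tij_def using nz by (simp add: s_form_def frac_eq_eq mult.commute)
  have "(inverse ((ai * aj) ^ 4 * (ai * ak) * inverse ai * c ^ 2) * (tk * Bi) + (bk * Ti) / inverse ((ai * aj) ^ 4 * (ai * ak) * inverse ai * c ^ 2)) * Tj =
     tj * (?q' * (tk * Bji) + bk * Tji / ?q')"
    unfolding Tji_def Bji_def d s_form_def using nz(5-)
    by (simp add: divide_simps) (simp add: algebra_simps eval_nat_numeral)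
  then show "Bij = s_form (inverse ((aj * ai * inverse aj) ^ 4 * (aj * ai * (aj * ak)) * inverse (aj * ai) * c ^ 2))
      (tk * Bji) (bk * Tji) Tj"
    unfolding p Bij_def using nz by (simp add: s_form_def frac_eq_eq mult.commute)
qed

lemma C_hom_s_form: "C_hom h \<Longrightarrow> h (s_form p x y d) = s_form (h p) (h x) (h y) (h d)"
  by (simp add: s_form_def C_hom_add C_hom_mult C_hom_divide)

lemma C_hom_w0_form: "C_hom h \<Longrightarrow> h (w0_form p x y w d) = w0_form (h p) (h x) (h y) (h w) (h d)"
  by (simp add: w0_form_def C_hom_add C_hom_mult C_hom_divide)

lemmas C_hom_simps = C_hom_mult C_hom_divide C_hom_inverse C_hom_power C_hom_s_form C_hom_w0_form

lemma C_hom_s: "C_hom (s i)"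
  by (rule C_automorphism_imp_C_hom, rule s_props(1)) (rule refl)+

lemma C_hom_w0: "C_hom w0"
  by (rule C_automorphism_imp_C_hom, rule w0_props(1)) (rule refl)+

lemmas C_hom_r = C_automorphism_imp_C_hom[OF r_props(1)]
lemmas C_hom_\<pi> = C_automorphism_imp_C_hom[OF \<pi>_props(1)]

lemmas trafo_simps = C_hom_simps[OF C_hom_s] C_hom_simps[OF C_hom_w0] C_hom_simps[OF C_hom_r]
  C_hom_simps[OF C_hom_\<pi>]

section \<open>Weyl group relations and commutation with w0 and r\<close>

context
  fixes i j k :: 3
  assumes jk: "j = i + 1" "k = i - 1"
begin

lemmas s_vals = s_props(2-)[OF jk]
lemmas s_next_vals = s_props(2-)[OF mod3_rotate(1,2)[OF jk]]
lemmas w0_vals = w0_props(2-)[OF jk] w0_props(2-)[OF mod3_rotate(1,2)[OF jk]]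
  w0_props(2-)[OF mod3_rotate(3,4)[OF jk]]

lemma s_nonzero:
  "s_form (\<alpha> i ^ 2 / (\<alpha> j * \<alpha> k * \<gamma> ^ 2)) (\<tau>v j * \<tau>bar k) (\<tau>bar j * \<tau>v k) (\<tau>bar i) \<noteq> 0"
  "s_form (inverse (\<alpha> i ^ 4 * \<alpha> j * \<alpha> k * \<gamma> ^ 2)) (\<tau>v j * \<tau>bar k) (\<tau>bar j * \<tau>v k) (\<tau>v i) \<noteq> 0"
  by (intro s_form_nonzero evaluates_one_intros)+

lemma s_involution: "s i \<circ> s i = id"
proof (intro C_hom_ext C_hom_comp C_hom_s C_hom_id)
  have "\<forall>v. s i (s i (X v)) = X v"
    unfolding var_forall3[OF jk]
    by (simp only: s_vals trafo_simps, intro conjI s_form_s_form s_nonzero)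
      (simp_all add: field_simps eval_nat_numeral)
  then show "(s i \<circ> s i) (X v) = id (X v)" for v by simp
qed

text \<open>\<open>r\<close> exchanges \<open>x\<close> and \<open>y\<close> and sends the
  coefficient for \<open>\<tau>v i\<close> to the reciprocal of that for \<open>\<tau>bar i\<close>;
  \<open>s_form\<close> is symmetric under swapping \<open>x\<close>, \<open>y\<close> and inverting
  \<open>p\<close>.\<close>

lemma s_r_commute: "s i \<circ> r = r \<circ> s i"
proof (intro C_hom_ext C_hom_comp C_hom_s C_hom_r)
  have "\<forall>v. s i (r (X v)) = r (s i (X v))"
    unfolding var_forall3[OF jk]
    by (simp only: s_vals r_props(2-) trafo_simps Q_cyclic[OF jk])
      (simp add: s_form_def field_simps eval_nat_numeral)
  then show "(s i \<circ> r) (X v) = (r \<circ> s i) (X v)" for v by simp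
qed

lemma s_w0_commute: "s i \<circ> w0 = w0 \<circ> s i"
proof (intro C_hom_ext C_hom_comp C_hom_s C_hom_w0)
  have "w0_form (\<gamma> ^ 4) (\<alpha> k ^ 2 / \<alpha> i ^ 2 * \<tau>v i * \<tau>v k * \<tau>bar j)
         (\<alpha> j ^ 2 / \<alpha> k ^ 2 * \<tau>v j * \<tau>v k * \<tau>bar i)
         (\<alpha> i ^ 2 / \<alpha> j ^ 2 * \<tau>v i * \<tau>v j * \<tau>bar k) (\<tau>bar j * \<tau>bar k) \<noteq> 0"
    by (intro w0_form_nonzero evaluates_one_intros)
  note * = s_form_w0_form_tau[OF this] s_form_w0_form_taubar s_form_w0_form_taubar_next[OF s_nonzero(2)]
  have "\<forall>v. s i (w0 (X v)) = w0 (s i (X v))"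
    unfolding var_forall3[OF jk]
    by (simp only: s_vals w0_vals trafo_simps) (simp only: * X_nonzero not_False_eq_True simp_thms)
  then show "(s i \<circ> w0) (X v) = (w0 \<circ> s i) (X v)" for v by simp
qed

lemma s_braid: "s i \<circ> s j \<circ> s i = s j \<circ> s i \<circ> s j"
proof (intro C_hom_ext C_hom_comp C_hom_s)
  have "s_form (\<alpha> j ^ 2 / (\<alpha> k * \<alpha> i * \<gamma> ^ 2)) (\<tau>v k * \<tau>bar i) (\<tau>bar k * \<tau>v i) (\<tau>bar j) \<noteq> 0"
    "s_form (inverse (\<alpha> j ^ 4 * \<alpha> k * \<alpha> i * \<gamma> ^ 2)) (\<tau>v k * \<tau>bar i) (\<tau>bar k * \<tau>v i) (\<tau>v j) \<noteq> 0"
    by (intro s_form_nonzero evaluates_one_intros)+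
  note * = s_nonzero this X_nonzero X_nonzero X_nonzero X_nonzero X_nonzero X_nonzero X_nonzero
    X_nonzero X_nonzero X_nonzero
  note b = braid_tau[OF *] braid_taubar[OF *] braid_tau_next[OF *, symmetric]
    braid_taubar_next[OF *, symmetric]
  have "\<forall>v. s i (s j (s i (X v))) = s j (s i (s j (X v)))"
    unfolding var_forall3[OF jk]
    by (simp only: s_vals s_next_vals trafo_simps b simp_thms) (simp add: field_simps)
  then show "(s i \<circ> s j \<circ> s i) (X v) = (s j \<circ> s i \<circ> s j) (X v)" for v by simp
qed

lemma \<pi>_s: "\<pi> \<circ> s i = s j \<circ> \<pi>"
proof (intro C_hom_ext C_hom_comp C_hom_s C_hom_\<pi>)
  have "\<forall>v. \<pi> (s i (X v)) = s j (\<pi> (X v))"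
    unfolding var_forall3[OF jk]
    by (simp only: s_vals s_next_vals trafo_simps \<pi>_props(2-) mod3_indices[OF jk] simp_thms)
  then show "(\<pi> \<circ> s i) (X v) = (s j \<circ> \<pi>) (X v)" for v by simp
qed

end

lemma \<pi>_r_commute: "\<pi> \<circ> r = r \<circ> \<pi>"
proof (intro C_hom_ext C_hom_comp C_hom_r C_hom_\<pi>)
  \<comment> \<open>Rotating index 2 produces the numeral 3 under simplification, which has to be
    identified with 0.\<close>
  have "(3 :: 3) = 0" by simp
  then have "\<alpha> 3 = \<alpha> 0" by (simp only:)
  then show "(\<pi> \<circ> r) (X v) = (r \<circ> \<pi>) (X v)" for v
    by (cases v) (simp_all add: r_props(2-) \<pi>_props(2-) trafo_simps Q_def mult_ac)
qed

lemma \<pi>_w0_commute: "\<pi> \<circ> w0 = w0 \<circ> \<pi>"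
proof (intro C_hom_ext C_hom_comp C_hom_w0 C_hom_\<pi>)
  have *: "1 = 0 + (1::3)" "2 = 0 - (1::3)" by simp_all
  have "\<forall>v. \<pi> (w0 (X v)) = w0 (\<pi> (X v))"
    unfolding var_forall3[OF *]
    by (simp only: w0_vals[OF *] \<pi>_props(2-) mod3_indices[OF *] trafo_simps simp_thms mult_ac)
  then show "(\<pi> \<circ> w0) (X v) = (w0 \<circ> \<pi>) (X v)" for v by simp
qed

section \<open>Commutation of the translations\<close>

lemma index_12: "2 = 1 + (1 :: 3)" "0 = 1 - (1 :: 3)" "0 = 2 + (1 :: 3)" "1 = 2 - (1 :: 3)"
   "1 = 0 + (1 :: 3)" "2 = 0 - (1 :: 3)"
  by simp_all

lemma comp_commute:
  "h \<circ> g = g \<circ> h \<Longrightarrow> h \<circ> g' = g' \<circ> h \<Longrightarrow> h \<circ> (g \<circ> g') = (g \<circ> g') \<circ> h"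
  by (metis comp_assoc)

text \<open>Collecting the rotations on the left turns the two products into
  \<open>\<pi> \<pi> s 1 s 2\<close> and \<open>\<pi> \<pi> s 2 s 1 s 2 s 1\<close>, equal by the
  braid relation and the involutivity of \<open>s 1\<close>.\<close>

lemma T1_T2_commute: "T1 \<circ> T2 = T2 \<circ> T1"
proof
  fix x
  note p = \<pi>_s[OF index_12(1,2), THEN fun_cong, simplified]
    \<pi>_s[OF index_12(3,4), THEN fun_cong, simplified]
    \<pi>_s[OF index_12(5,6), THEN fun_cong, simplified]
  note b = s_braid[OF index_12(1,2), THEN fun_cong, simplified]
  have i: "s 1 (s 1 x) = x" for x
    using s_involution[OF index_12(1,2), THEN fun_cong] by simp
  have "(T1 \<circ> T2) x = \<pi> (\<pi> (s 1 (s 2 x)))"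
    by (simp add: T1_def T2_def i p)
  also have "s 1 (s 2 x) = s 2 (s 1 (s 2 (s 1 x)))"
    by (simp add: i flip: b)
  also have "\<pi> (\<pi> (s 2 (s 1 (s 2 (s 1 x))))) = (T2 \<circ> T1) x"
    by (simp add: T1_def T2_def p)
  finally show "(T1 \<circ> T2) x = (T2 \<circ> T1) x" .
qed

lemma T4_s_commute: "T4 \<circ> s i = s i \<circ> T4"
  unfolding T4_def
  by (rule comp_commute[symmetric]) (simp_all only: s_r_commute[OF refl refl] s_w0_commute[OF refl refl])

lemma T4_\<pi>_commute: "T4 \<circ> \<pi> = \<pi> \<circ> T4"
  unfolding T4_def
  by (rule comp_commute[symmetric]) (simp_all only: \<pi>_r_commute \<pi>_w0_commute)

lemma T4_T1_commute: "T4 \<circ> T1 = T1 \<circ> T4"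
  unfolding T1_def by (intro comp_commute T4_s_commute T4_\<pi>_commute)

lemma T4_T2_commute: "T4 \<circ> T2 = T2 \<circ> T4"
  unfolding T2_def by (intro comp_commute T4_s_commute T4_\<pi>_commute)

subsection \<open>Translations\<close>

lemma C_automorphism_comp: "C_automorphism g \<Longrightarrow> C_automorphism h \<Longrightarrow> C_automorphism (g \<circ> h)"
  unfolding C_automorphism_def by (auto intro: bij_comp)

lemma C_automorphism_id: "C_automorphism id"
  by (simp add: C_automorphism_def)

lemma C_automorphism_inv:
  assumes "C_automorphism h"
  shows "C_automorphism (inv h)"
proof -
  have b: "bij h" and h: "\<And>x y. h (x + y) = h x + h y" "\<And>x y. h (x * y) = h x * h y" "\<And>c. h (const c) = const c"
    using assms by (auto simp: C_automorphism_def)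
  have *: "inv h x = y \<longleftrightarrow> x = h y" for x y
    using b by (metis bij_inv_eq_iff)
  have **: "h (inv h x) = x" for x
    using b by (simp add: bij_is_surj surj_f_inv_f)
  show ?thesis
    unfolding C_automorphism_def using b by (auto simp: * ** h bij_imp_bij_inv)
qed

lemma C_automorphism_funpow: "C_automorphism h \<Longrightarrow> C_automorphism (h ^^ n)"
  by (induction n) (simp_all add: C_automorphism_id C_automorphism_comp del: comp_apply)

lemma C_automorphism_int_iterate: "C_automorphism h \<Longrightarrow> C_automorphism (int_iterate h k)"
  by (simp add: int_iterate_def C_automorphism_funpow C_automorphism_inv)

lemma C_automorphism_T: "C_automorphism T1" "C_automorphism T2" "C_automorphism T4"
  unfolding T1_def T2_def T4_def
  by (intro C_automorphism_comp \<pi>_props(1) r_props(1) s_props(1)[OF refl refl] w0_props(1)[OF refl refl])+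

section \<open>Integer iterates of a bijection\<close>

lemma int_iterate_0 [simp]: "int_iterate h 0 = id"
  by (simp add: int_iterate_def)

lemma int_iterate_Suc:
  assumes "bij h"
  shows "int_iterate h (k + 1) x = h (int_iterate h k x)"
proof (cases "k \<ge> 0")
  case True
  then show ?thesis by (simp add: int_iterate_def nat_add_distrib)
next
  case False
  define n where "n = nat (- k - 1)"
  with False have n: "nat (- k) = Suc n" "nat (- (k + 1)) = n" by auto
  have "h (inv h y) = y" for y
    using assms by (simp add: bij_is_surj surj_f_inv_f)
  \<comment> \<open>At \<open>k = -1\<close> the successor is 0 and already falls into the
    nonnegative branch of the definition.\<close>
  with False show ?thesis
    by (cases "k = -1") (simp_all add: int_iterate_def n del: minus_add_distrib)
qed

lemma int_iterate_add:
  assumes "bij h"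
  shows "int_iterate h (k + l) x = int_iterate h k (int_iterate h l x)"
proof (induction k rule: int_induct[of _ 0])
  case (step1 i)
  then show ?case
    using int_iterate_Suc[OF assms, of "i + l"] int_iterate_Suc[OF assms, of i] by (simp add: algebra_simps)
next
  case (step2 i)
  have "h (int_iterate h (i - 1 + l) x) = h (int_iterate h (i - 1) (int_iterate h l x))"
    using step2 int_iterate_Suc[OF assms, of "i - 1 + l"] int_iterate_Suc[OF assms, of "i - 1"]
    by (simp add: algebra_simps)
  then show ?case using assms by (simp add: bij_is_inj inj_eq)
qed simp

lemma int_iterate_commute:
  assumes "bij h" "\<And>x. h (g x) = g (h x)"
  shows "int_iterate h k (g x) = g (int_iterate h k x)"
proof (induction k rule: int_induct[of _ 0])
  case (step1 i)
  then show ?case by (simp add: int_iterate_Suc assms)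
next
  case (step2 i)
  have "h (int_iterate h (i - 1) (g x)) = h (g (int_iterate h (i - 1) x))"
    using step2 int_iterate_Suc[OF assms(1), of "i - 1"] by (simp add: assms(2))
  then show ?case by (rule injD[OF bij_is_inj[OF assms(1)]])
qed simp

lemma int_iterate_commute2:
  assumes "bij h" "bij g" "\<And>x. h (g x) = g (h x)"
  shows "int_iterate h k (int_iterate g l x) = int_iterate g l (int_iterate h k x)"
  by (intro int_iterate_commute assms(1)) (simp add: int_iterate_commute assms)

text \<open>Each parameter is an eigenvector of each translation with multiplier 1, \<open>Q\<close>
  or \<open>inverse Q\<close>, itself fixed, so the factors simply accumulate.\<close>

lemma int_iterate_scale:
  assumes "C_automorphism h" "h y = y" "h x = y * x" "y \<noteq> 0"
  shows "int_iterate h k x = y powi k * x"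
proof -
  note hom = C_automorphism_imp_C_hom[OF assms(1)]
  have b: "bij h" using assms(1) by (simp add: C_automorphism_def)
  have h: "h (y powi k * x) = y powi (k + 1) * x" for k
    using assms(2-) by (simp add: C_hom_mult[OF hom] C_hom_power_int[OF hom] power_int_add_1)
  show ?thesis
  proof (induction k rule: int_induct[of _ 0])
    case (step1 i)
    then show ?case by (simp add: int_iterate_Suc b h)
  next
    case (step2 i)
    have "h (int_iterate h (i - 1) x) = h (y powi (i - 1) * x)"
      using step2 int_iterate_Suc[OF b, of "i - 1"] h[of "i - 1"] by simp
    then show ?case using b by (simp add: bij_is_inj inj_eq)
  qed simp
qed

text \<open>
  With \<open>W = \<tau>\<^sup>N\<^sup>+\<^sup>1 / \<tau>\<^sup>N\<close>, the bilinear equations say that the difference of \<open>z\<close> across an edge of the lattice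
  is a coefficient times the product of the \<open>W\<close> at its two ends. Each \<open>W\<close> occurs once in the
  numerator and once in the denominator of the cross-ratio and cancels.
\<close>

lemma schwarzian_kdv_of_bilinear:
  fixes K :: "'a :: field"
  assumes e: "y00 * t10 - \<kappa> * y10 * t00 + A * D * w10 * w00 = 0"
    "y01 * t11 - \<kappa> * y11 * t01 + A' * D * w11 * w01 = 0"
    "y00 * t01 - \<kappa> * y01 * t00 + B * D * w01 * w00 = 0"
    "y10 * t11 - \<kappa> * y11 * t10 + B' * D * w11 * w10 = 0"
   and nz: "t00 \<noteq> 0" "t10 \<noteq> 0" "t01 \<noteq> 0" "t11 \<noteq> 0" "w00 \<noteq> 0" "w10 \<noteq> 0" "w01 \<noteq> 0" "w11 \<noteq> 0"
     "D \<noteq> 0" "K \<noteq> 0" "\<kappa> \<noteq> 0" "B \<noteq> 0" "B' \<noteq> 0"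
  shows "(K * (y00 / t00) - K * \<kappa> * (y10 / t10)) * (K * \<kappa> * \<kappa> * (y11 / t11) - K * \<kappa> * (y01 / t01)) /
     ((K * \<kappa> * (y10 / t10) - K * \<kappa> * \<kappa> * (y11 / t11)) * (K * \<kappa> * (y01 / t01) - K * (y00 / t00)))
    = A * A' / (B * B')"
proof -
  \<comment> \<open>Divide the bilinear equation by \<open>t * t'\<close>. Its coefficient
    \<open>\<kappa>\<close> is exactly the factor gained by the prefactor of \<open>z\<close> along
    an edge.\<close>
  have diff: "L * (y / t) - L * \<kappa> * (y' / t') = - (L * C * D * w' * w / (t * t'))"
    if "y * t' - \<kappa> * y' * t + C * D * w' * w = 0" "t \<noteq> 0" "t' \<noteq> 0" for L y t y' t' C w w'
  proof -
    have "y * t' - \<kappa> * y' * t = - (C * D * w' * w)"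
      using that(1) by (simp add: eq_neg_iff_add_eq_0)
    then have "L * (y * t' - \<kappa> * y' * t) / (t * t') = L * - (C * D * w' * w) / (t * t')" by simp
    then show ?thesis using that(2,3) by (simp add: field_simps)
  qed
  have 1: "K * (y00 / t00) - K * \<kappa> * (y10 / t10) = - (K * A * D * w10 * w00 / (t00 * t10))"
    by (rule diff) (use e nz in auto)
  have 2: "K * \<kappa> * \<kappa> * (y11 / t11) - K * \<kappa> * (y01 / t01) = K * \<kappa> * A' * D * w11 * w01 / (t01 * t11)"
    using diff[OF e(2) nz(3,4), of "K * \<kappa>"] by (simp add: algebra_simps)
  have 3: "K * \<kappa> * (y10 / t10) - K * \<kappa> * \<kappa> * (y11 / t11) = - (K * \<kappa> * B' * D * w11 * w10 / (t10 * t11))"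
    by (rule diff) (use e nz in auto)
  have 4: "K * \<kappa> * (y01 / t01) - K * (y00 / t00) = K * B * D * w01 * w00 / (t00 * t01)"
    using diff[OF e(3) nz(1,3), of K] by (simp add: algebra_simps)
  show ?thesis unfolding 1 2 3 4 using nz
    by (simp add: field_simps)
qed

text \<open>
  Here \<open>Bi\<close> and \<open>Bj\<close> are the images of the barred variables under \<open>T4 = r w0\<close>: the roles of \<open>ti\<close> and \<open>bi\<close> are
  exchanged and \<open>c\<close> is \<open>r \<gamma>\<close>.
\<close>

lemma bilinear_identity:
  fixes ai aj ak c g ti tj tk bi bj bk :: "'a :: field"
  defines "Bi \<equiv> w0_form (c ^ 4) (ak ^ 2 / ai ^ 2 * bi * bk * tj) (aj ^ 2 / ak ^ 2 * bj * bk * ti)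
      (ai ^ 2 / aj ^ 2 * bi * bj * tk) (tj * tk)"
    and "Bj \<equiv> w0_form (c ^ 4) (ai ^ 2 / aj ^ 2 * bj * bi * tk) (ak ^ 2 / ai ^ 2 * bk * bi * tj)
      (aj ^ 2 / ak ^ 2 * bj * bk * ti) (tk * ti)"
  assumes nz: "ai \<noteq> 0" "aj \<noteq> 0" "ak \<noteq> 0" "g \<noteq> 0" "ti \<noteq> 0" "tj \<noteq> 0" "tk \<noteq> 0"
    and c: "c = inverse (ai * aj * ak) * inverse g"
  shows "Bi * tj - (ai * aj * ak) ^ 4 * g ^ 4 * Bj * ti
    + (ai * aj * ak) powi (-4) * g powi (-4) * (ai ^ 2 / aj ^ 2) * ((ai * aj * ak) ^ 12 * g ^ 12 - 1) * bj * bi = 0"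
proof -
  let ?p = "c ^ 4"
  have c0: "c \<noteq> 0" using nz c by simp
  have "(ai * aj * ak) ^ 4 * g ^ 4 = inverse ?p" "(ai * aj * ak) powi (-4) * g powi (-4) = ?p"
    "(ai * aj * ak) ^ 12 * g ^ 12 = inverse ?p ^ 3"
    using nz by (simp_all add: c field_simps power_int_minus)
  \<comment> \<open>The terms with \<open>bi * bk * tj\<close> and \<open>bj * bk * ti\<close>
    cancel between the first two products. What remains is \<open>ai ^ 2 / aj ^ 2 * bi * bj\<close>
    times \<open>?p - inverse ?p ^ 2\<close>, which the third product removes.\<close>
  moreover have "Bi * tj - inverse ?p * Bj * ti + ?p * (ai ^ 2 / aj ^ 2) * (inverse ?p ^ 3 - 1) * bj * bi = 0"
    unfolding Bi_def Bj_def w0_form_def using nz c0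
    by (simp add: divide_simps) (simp add: algebra_simps eval_nat_numeral)
  ultimately show ?thesis by simp
qed

section \<open>Action of the translations on parameters and on the lattice\<close>

lemmas generator_vals = s_props(2-)[OF index_12(1,2)] s_props(2-)[OF index_12(3,4)] \<pi>_props(2-)
  w0_props(2-)[OF index_12(5,6)] r_props(2-)

lemma three_eq_0: "(3 :: 3) = 0" "(2 :: 3) + 1 = 0" "(1 :: 3) + 1 = 2" "(0 :: 3) + 1 = 1"
  by simp_all

lemma T1_vals: "T1 (\<alpha> 0) = Q * \<alpha> 0" "T1 (\<alpha> 1) = inverse Q * \<alpha> 1" "T1 (\<alpha> 2) = \<alpha> 2" "T1 \<gamma> = \<gamma>"
    "T1 (\<tau>v 0) = \<tau>v 1" "T1 (\<tau>bar 0) = \<tau>bar 1"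
  by (simp_all only: T1_def comp_apply generator_vals trafo_simps three_eq_0 Q_def) (simp_all add: field_simps)

lemma T2_vals: "T2 (\<alpha> 0) = \<alpha> 0" "T2 (\<alpha> 1) = Q * \<alpha> 1" "T2 (\<alpha> 2) = inverse Q * \<alpha> 2" "T2 \<gamma> = \<gamma>"
    "T2 (\<tau>v 1) = \<tau>v 2" "T2 (\<tau>bar 1) = \<tau>bar 2"
  by (simp_all only: T2_def comp_apply generator_vals trafo_simps three_eq_0 Q_def) (simp_all add: field_simps)

lemma T4_vals: "T4 (\<alpha> l) = \<alpha> l" "T4 \<gamma> = Q * \<gamma>" "T4 (\<tau>v l) = \<tau>bar l"
  by (simp_all only: T4_def comp_apply generator_vals trafo_simps three_eq_0) (simp_all add: field_simps)

lemma Q_nonzero [simp]: "Q \<noteq> 0"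
  by (simp add: Q_def)

lemma T_Q: "T1 Q = Q" "T2 Q = Q" "T4 Q = Q"
proof -
  note hom = C_automorphism_T[THEN C_automorphism_imp_C_hom]
  have "Q * \<alpha> 0 * (inverse Q * \<alpha> 1) * \<alpha> 2 = Q" "\<alpha> 0 * (Q * \<alpha> 1) * (inverse Q * \<alpha> 2) = Q"
    by (simp_all add: field_simps) (simp_all add: Q_def)
  then show "T1 Q = Q" "T2 Q = Q" "T4 Q = Q"
    unfolding Q_def
    by (simp_all only: C_hom_mult[OF hom(1)] C_hom_mult[OF hom(2)] C_hom_mult[OF hom(3)] T1_vals T2_vals T4_vals)
      (simp_all only: Q_def)
qed

lemma bij_T: "bij T1" "bij T2" "bij T4"
  using C_automorphism_T by (simp_all add: C_automorphism_def)

lemma T_commute: "T1 (T2 x) = T2 (T1 x)" "T4 (T1 x) = T1 (T4 x)" "T4 (T2 x) = T2 (T4 x)"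
  using T1_T2_commute T4_T1_commute T4_T2_commute by (metis comp_apply)+

definition translation :: "int \<Rightarrow> int \<Rightarrow> int \<Rightarrow> ratfun \<Rightarrow> ratfun" where
  "translation n m N x = int_iterate T1 n (int_iterate T2 m (int_iterate T4 N x))"

lemma C_automorphism_translation: "C_automorphism (translation n m N)"
proof -
  have "translation n m N = int_iterate T1 n \<circ> int_iterate T2 m \<circ> int_iterate T4 N"
    by (auto simp: translation_def)
  then show ?thesis
    by (simp only: C_automorphism_comp C_automorphism_int_iterate C_automorphism_T)
qed

lemmas C_hom_translation = C_automorphism_translation[THEN C_automorphism_imp_C_hom]

lemma translation_add: "translation (n + n') (m + m') (N + N') x = translation n m N (translation n' m' N' x)"
  unfolding translation_def int_iterate_add[OF bij_T(1)] int_iterate_add[OF bij_T(2)] int_iterate_add[OF bij_T(3)]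
  by (simp only: int_iterate_commute2[where h = T1 and g = T2, OF bij_T(1,2) T_commute(1)]
      int_iterate_commute2[where h = T4 and g = T1, OF bij_T(3,1) T_commute(2)]
      int_iterate_commute2[where h = T4 and g = T2, OF bij_T(3,2) T_commute(3)])

lemma translation_vals: "translation n m N (\<alpha> 0) = Q powi n * \<alpha> 0"
  "translation n m N (\<alpha> 1) = Q powi (m - n) * \<alpha> 1"
  "translation n m N (\<alpha> 2) = Q powi (- m) * \<alpha> 2"
  "translation n m N \<gamma> = Q powi N * \<gamma>" "translation n m N Q = Q"
proof -
  note sc = int_iterate_scale[OF C_automorphism_T(1)] int_iterate_scale[OF C_automorphism_T(2)]
    int_iterate_scale[OF C_automorphism_T(3)]
  note hom = C_automorphism_int_iterate[OF C_automorphism_T(1), THEN C_automorphism_imp_C_hom]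
    C_automorphism_int_iterate[OF C_automorphism_T(2), THEN C_automorphism_imp_C_hom]
    C_automorphism_int_iterate[OF C_automorphism_T(3), THEN C_automorphism_imp_C_hom]
  note hom' = hom[THEN C_hom_mult] hom[THEN C_hom_power_int]
  have 1: "T1 (inverse Q) = inverse Q" "T2 (inverse Q) = inverse Q" "T1 1 = 1" "T2 1 = 1" "T4 1 = 1"
    using C_automorphism_T[THEN C_automorphism_imp_C_hom]
    by (simp_all add: C_hom_inverse C_hom_1 T_Q)
  have v1: "int_iterate T1 k (\<alpha> 0) = Q powi k * \<alpha> 0" "int_iterate T1 k (\<alpha> 1) = inverse Q powi k * \<alpha> 1"
    "int_iterate T1 k (\<alpha> 2) = 1 powi k * \<alpha> 2" "int_iterate T1 k \<gamma> = 1 powi k * \<gamma>" "int_iterate T1 k Q = 1 powi k * Q" for k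
    by (rule sc; simp add: T1_vals T_Q 1)+
  have v2: "int_iterate T2 k (\<alpha> 0) = 1 powi k * \<alpha> 0" "int_iterate T2 k (\<alpha> 1) = Q powi k * \<alpha> 1"
    "int_iterate T2 k (\<alpha> 2) = inverse Q powi k * \<alpha> 2" "int_iterate T2 k \<gamma> = 1 powi k * \<gamma>" "int_iterate T2 k Q = 1 powi k * Q" for k
    by (rule sc; simp add: T2_vals T_Q 1)+
  have v4: "int_iterate T4 k (\<alpha> l) = 1 powi k * \<alpha> l"
    "int_iterate T4 k \<gamma> = Q powi k * \<gamma>" "int_iterate T4 k Q = 1 powi k * Q" for k l
    by (rule sc; simp add: T4_vals T_Q 1)+
  note v = v1[simplified] v2[simplified] v4[simplified]
  show "translation n m N (\<alpha> 0) = Q powi n * \<alpha> 0"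
  "translation n m N (\<alpha> 1) = Q powi (m - n) * \<alpha> 1"
  "translation n m N (\<alpha> 2) = Q powi (- m) * \<alpha> 2"
  "translation n m N \<gamma> = Q powi N * \<gamma>" "translation n m N Q = Q"
    unfolding translation_def by (simp_all add: v hom' hom[THEN C_hom_inverse] hom[THEN C_hom_divide] power_int_diff power_int_inverse power_int_minus field_simps)
qed

lemma \<tau>_add: "\<tau> (n + n') (m + m') (N + N') = translation n m N (\<tau> n' m' N')"
  using translation_add by (simp add: \<tau>_def translation_def)

lemma int_iterate_1: "bij h \<Longrightarrow> int_iterate h 1 x = h x" "bij h \<Longrightarrow> int_iterate h 2 x = h (h x)"
  using int_iterate_Suc[of h 0] int_iterate_Suc[of h 1] by simp_all

text \<open>A bilinear equation involves three consecutive layers in \<open>N\<close>. The variables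
  supply layers 0 and 1; layer 2 is one further application of \<open>T4\<close>.\<close>

lemma \<tau>_base:
  "\<tau> (-1) 0 0 = \<tau>v 0" "\<tau> 0 0 0 = \<tau>v 1" "\<tau> 0 1 0 = \<tau>v 2"
  "\<tau> (-1) 0 1 = \<tau>bar 0" "\<tau> 0 0 1 = \<tau>bar 1" "\<tau> 0 1 1 = \<tau>bar 2"
  "\<tau> (-1) 0 2 = T4 (\<tau>bar 0)" "\<tau> 0 0 2 = T4 (\<tau>bar 1)" "\<tau> 0 1 2 = T4 (\<tau>bar 2)"
proof -
  have 1: "int_iterate T1 (-1) (T1 x) = x" for x
    using int_iterate_add[OF bij_T(1), of "-1" 1] by (simp add: int_iterate_1 bij_T)
  have 2: "T1 (T4 (\<tau>bar 0)) = T4 (\<tau>bar 1)" "T2 (T4 (\<tau>bar 1)) = T4 (\<tau>bar 2)"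
    by (simp_all only: T1_vals T2_vals T_commute[symmetric])
  show "\<tau> (-1) 0 0 = \<tau>v 0" "\<tau> 0 0 0 = \<tau>v 1" "\<tau> 0 1 0 = \<tau>v 2"
    "\<tau> (-1) 0 1 = \<tau>bar 0" "\<tau> 0 0 1 = \<tau>bar 1" "\<tau> 0 1 1 = \<tau>bar 2"
    "\<tau> (-1) 0 2 = T4 (\<tau>bar 0)" "\<tau> 0 0 2 = T4 (\<tau>bar 1)" "\<tau> 0 1 2 = T4 (\<tau>bar 2)"
    using 1[of "\<tau>v 0"] 1[of "\<tau>bar 0"] 1[of "T4 (\<tau>bar 0)", unfolded 2]
    by (simp_all add: \<tau>_def int_iterate_1 bij_T T1_vals T2_vals T4_vals 2)
qed

subsection \<open>The bilinear equations and the Schwarzian KdV equation\<close>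

lemma T4_taubar:
  assumes "j = i + 1" "k = i - 1"
  shows
    "T4 (\<tau>bar i) * \<tau>v j - Q ^ 4 * \<gamma> ^ 4 * T4 (\<tau>bar j) * \<tau>v i
     + Q powi (-4) * \<gamma> powi (-4) * (\<alpha> i ^ 2 / \<alpha> j ^ 2) * (Q ^ 12 * \<gamma> ^ 12 - 1) * \<tau>bar j * \<tau>bar i = 0"
proof -
  have "inverse Q * inverse \<gamma> = inverse (\<alpha> i * \<alpha> j * \<alpha> k) * inverse \<gamma>"
    by (simp add: Q_cyclic[OF assms])
  note * = bilinear_identity[OF X_nonzero X_nonzero X_nonzero X_nonzero X_nonzero X_nonzero X_nonzero this,
     folded Q_cyclic[OF assms]]
  show ?thesis
    unfolding T4_def comp_apply w0_vals[OF assms] trafo_simps r_props by (rule *)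
qed

lemmas translation_hom = C_hom_translation[THEN C_hom_add] C_hom_translation[THEN C_hom_diff]
  C_hom_translation[THEN C_hom_mult] C_hom_translation[THEN C_hom_power]
  C_hom_translation[THEN C_hom_power_int] C_hom_translation[THEN C_hom_divide]
  C_hom_translation[THEN C_hom_1] C_hom_translation[THEN C_hom_0]

text \<open>The base relation lies at layer 1, so only \<open>N - 1\<close> steps of
  \<open>T4\<close> act on \<open>\<gamma>\<close>; the powers of \<open>Q\<close> already present
  supply the missing step.\<close>

lemma Q_\<gamma>_shift:
  "Q ^ 4 * (Q powi (N - 1) * \<gamma>) ^ 4 = Q powi (4 * N) * \<gamma> ^ 4"
  "Q ^ 12 * (Q powi (N - 1) * \<gamma>) ^ 12 = Q powi (12 * N) * \<gamma> ^ 12"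
  by (simp_all add: power_int_diff power_int_mult mult.commute[of 4] mult.commute[of 12] field_simps)

text \<open>
  The two equations are the translates of the same relation between the variables with indices
  \<open>0, 1\<close> and \<open>1, 2\<close> respectively, that is, of the case \<open>N = 1\<close> at \<open>(n, m) = (-1, 0)\<close> and \<open>(0, 0)\<close>.
\<close>

lemma bilinear_n:
    "\<tau> n m (N + 1) * \<tau> (n + 1) m (N - 1)
        - Q powi (4 * N) * \<gamma> ^ 4 * \<tau> (n + 1) m (N + 1) * \<tau> n m (N - 1)
        + Q powi (4 * n - 2 * m - 4 * N) * \<gamma> powi (- 4) * \<alpha> 0 ^ 6 * \<alpha> 1 ^ 2 * \<alpha> 2 ^ 4
          * (Q powi (12 * N) * \<gamma> ^ 12 - 1) * \<tau> (n + 1) m N * \<tau> n m N = 0"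
proof -
  let ?T = "translation (n + 1) m (N - 1)"
  have \<tau>: "?T (\<tau>v 0) = \<tau> n m (N - 1)" "?T (\<tau>v 1) = \<tau> (n + 1) m (N - 1)"
      "?T (\<tau>bar 0) = \<tau> n m N" "?T (\<tau>bar 1) = \<tau> (n + 1) m N"
      "?T (T4 (\<tau>bar 0)) = \<tau> n m (N + 1)" "?T (T4 (\<tau>bar 1)) = \<tau> (n + 1) m (N + 1)"
    unfolding \<tau>_base(7-9)[symmetric] unfolding \<tau>_base(1-6)[symmetric] \<tau>_add[symmetric] by (simp_all add: add.commute)
  have coeff: "Q powi (-4) * (Q powi (N - 1) * \<gamma>) powi (-4) * ((Q powi (n + 1) * \<alpha> 0) ^ 2 / (Q powi (m - (n + 1)) * \<alpha> 1) ^ 2)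
     = Q powi (4 * n - 2 * m - 4 * N) * \<gamma> powi (- 4) * \<alpha> 0 ^ 6 * \<alpha> 1 ^ 2 * \<alpha> 2 ^ 4"
  proof -
    define x y w where "x = Q powi n" and "y = Q powi m" and "w = Q powi N"
    have nz: "x \<noteq> 0" "y \<noteq> 0" "w \<noteq> 0" by (simp_all add: x_def y_def w_def)
    \<comment> \<open>The shift by \<open>n + 1\<close> instead of \<open>n\<close> leaves a surplus
      \<open>Q ^ 4\<close>, which turns the quotient of squares into the stated monomial.\<close>
    have "\<alpha> 0 ^ 6 * \<alpha> 1 ^ 2 * \<alpha> 2 ^ 4 = Q ^ 4 * (\<alpha> 0 ^ 2 / \<alpha> 1 ^ 2)"
      by (simp add: Q_def field_simps)
    moreover have "Q powi (4 * n - 2 * m - 4 * N) = x ^ 4 / y ^ 2 / w ^ 4"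
      by (simp add: power_int_diff power_int_mult mult.commute[of 4] mult.commute[of 2] x_def y_def w_def)
    ultimately show ?thesis
      using nz
      by (simp add: power_int_diff power_int_add power_int_minus field_simps flip: x_def y_def w_def)
  qed
  have "?T (T4 (\<tau>bar 0) * \<tau>v 1 - Q ^ 4 * \<gamma> ^ 4 * T4 (\<tau>bar 1) * \<tau>v 0
     + Q powi (-4) * \<gamma> powi (-4) * (\<alpha> 0 ^ 2 / \<alpha> 1 ^ 2) * (Q ^ 12 * \<gamma> ^ 12 - 1) * \<tau>bar 1 * \<tau>bar 0) = ?T 0"
    by (simp only: T4_taubar[OF index_12(5,6)])
  then show ?thesis
    unfolding translation_hom translation_vals \<tau> Q_\<gamma>_shift coeff .
qed

lemma bilinear_m:
    "\<tau> n m (N + 1) * \<tau> n (m + 1) (N - 1)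
        - Q powi (4 * N) * \<gamma> ^ 4 * \<tau> n (m + 1) (N + 1) * \<tau> n m (N - 1)
        + Q powi (4 * m - 2 * n - 4 * N) * \<gamma> powi (- 4) * \<alpha> 1 ^ 2 * \<alpha> 2 powi (- 2)
          * (Q powi (12 * N) * \<gamma> ^ 12 - 1) * \<tau> n (m + 1) N * \<tau> n m N = 0"
proof -
  let ?T = "translation n m (N - 1)"
  have \<tau>: "?T (\<tau>v 1) = \<tau> n m (N - 1)" "?T (\<tau>v 2) = \<tau> n (m + 1) (N - 1)"
      "?T (\<tau>bar 1) = \<tau> n m N" "?T (\<tau>bar 2) = \<tau> n (m + 1) N"
      "?T (T4 (\<tau>bar 1)) = \<tau> n m (N + 1)" "?T (T4 (\<tau>bar 2)) = \<tau> n (m + 1) (N + 1)"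
    unfolding \<tau>_base(7-9)[symmetric] unfolding \<tau>_base(1-6)[symmetric] \<tau>_add[symmetric] by (simp_all add: add.commute)
  have coeff: "Q powi (-4) * (Q powi (N - 1) * \<gamma>) powi (-4) * ((Q powi (m - n) * \<alpha> 1) ^ 2 / (Q powi (- m) * \<alpha> 2) ^ 2)
     = Q powi (4 * m - 2 * n - 4 * N) * \<gamma> powi (- 4) * \<alpha> 1 ^ 2 * \<alpha> 2 powi (- 2)"
  proof -
    define x y w where "x = Q powi n" and "y = Q powi m" and "w = Q powi N"
    have nz: "x \<noteq> 0" "y \<noteq> 0" "w \<noteq> 0" by (simp_all add: x_def y_def w_def)
    have "Q powi (4 * m - 2 * n - 4 * N) = y ^ 4 / x ^ 2 / w ^ 4"
      by (simp add: power_int_diff power_int_mult mult.commute[of 4] mult.commute[of 2] x_def y_def w_def)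
    then show ?thesis
      using nz
      by (simp add: power_int_diff power_int_add power_int_minus field_simps flip: x_def y_def w_def)
  qed
  have "?T (T4 (\<tau>bar 1) * \<tau>v 2 - Q ^ 4 * \<gamma> ^ 4 * T4 (\<tau>bar 2) * \<tau>v 1
     + Q powi (-4) * \<gamma> powi (-4) * (\<alpha> 1 ^ 2 / \<alpha> 2 ^ 2) * (Q ^ 12 * \<gamma> ^ 12 - 1) * \<tau>bar 2 * \<tau>bar 1) = ?T 0"
    by (simp only: T4_taubar[OF index_12(1,2)])
  then show ?thesis
    unfolding translation_hom translation_vals \<tau> Q_\<gamma>_shift coeff .
qed

lemma \<tau>_nonzero: "\<tau> n m N \<noteq> 0"
  using C_hom_eq_0_iff[OF C_hom_translation, of n m N "\<tau>v 1"] by (simp add: \<tau>_def translation_def)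

text \<open>This is the image of \<open>\<gamma> ^ 12 - 1\<close> under an automorphism, and
  evaluating \<open>\<gamma>\<close> at 2 shows that the latter is nonzero. The cross-ratio needs it
  because the factor occurs in every edge difference.\<close>

lemma Q_\<gamma>_nonzero: "Q powi (12 * N) * \<gamma> ^ 12 - 1 \<noteq> 0"
proof -
  let ?g = "\<lambda>v. if v = Gamma then const 2 else 1"
  have "evaluates ?g (\<gamma> ^ 12) (const 2 ^ 12)"
    using evaluates_power[OF evaluates_X[of ?g Gamma]] by simp
  moreover have "const 2 ^ 12 \<noteq> 1"
    using const_of_nat[of 2] by simp
  ultimately have "\<gamma> ^ 12 - 1 \<noteq> 0"
    using evaluates_1 evaluates_unique by fastforce
  moreover have "translation 0 0 N (\<gamma> ^ 12 - 1) = Q powi (12 * N) * \<gamma> ^ 12 - 1"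
    by (simp add: translation_hom translation_vals
       power_mult_distrib power_int_mult mult.commute[of 12])
  ultimately show ?thesis
    using C_hom_eq_0_iff[OF C_hom_translation] by metis
qed

lemma schwarzian_kdv:
  "(z N n m - z N (n + 1) m) * (z N (n + 1) (m + 1) - z N n (m + 1))
        / ((z N (n + 1) m - z N (n + 1) (m + 1)) * (z N n (m + 1) - z N n m))
        = q powi (2 * n - 2 * m) * a 0 ^ 2 * a 2 ^ 2"
proof -
  define \<kappa> where "\<kappa> = Q powi (4 * N + 4) * \<gamma> ^ 4"
  define K where "K = \<kappa> powi (n + m)"
  define A where "A n m = Q powi (4 * n - 2 * m - 4 * (N + 1)) * \<gamma> powi (- 4) * \<alpha> 0 ^ 6 * \<alpha> 1 ^ 2 * \<alpha> 2 ^ 4" for n m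
  define B where "B n m = Q powi (4 * m - 2 * n - 4 * (N + 1)) * \<gamma> powi (- 4) * \<alpha> 1 ^ 2 * \<alpha> 2 powi (- 2)" for n m
  have \<kappa>: "\<kappa> \<noteq> 0" by (simp add: \<kappa>_def)
  then have K: "K \<noteq> 0" by (simp add: K_def)
  have z: "z N n m = \<kappa> powi (n + m) * (\<tau> n m (N + 2) / \<tau> n m N)" for n m
    by (simp only: z_def \<kappa>_def)
  have z': "z N n m = K * (\<tau> n m (N + 2) / \<tau> n m N)"
    "z N (n + 1) m = K * \<kappa> * (\<tau> (n + 1) m (N + 2) / \<tau> (n + 1) m N)"
    "z N n (m + 1) = K * \<kappa> * (\<tau> n (m + 1) (N + 2) / \<tau> n (m + 1) N)"
    "z N (n + 1) (m + 1) = K * \<kappa> * \<kappa> * (\<tau> (n + 1) (m + 1) (N + 2) / \<tau> (n + 1) (m + 1) N)"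
    unfolding z by (simp_all add: K_def \<kappa> power_int_add power2_eq_square)
  \<comment> \<open>The bilinear equations are taken at layer \<open>N + 1\<close>, so that their
    outer layers are the \<open>N\<close> and \<open>N + 2\<close> in \<open>z\<close>.\<close>
  have e: "\<tau> n m (N + 2) * \<tau> (n + 1) m N - \<kappa> * \<tau> (n + 1) m (N + 2) * \<tau> n m N
      + A n m * (Q powi (12 * (N + 1)) * \<gamma> ^ 12 - 1) * \<tau> (n + 1) m (N + 1) * \<tau> n m (N + 1) = 0"
    "\<tau> n m (N + 2) * \<tau> n (m + 1) N - \<kappa> * \<tau> n (m + 1) (N + 2) * \<tau> n m N
      + B n m * (Q powi (12 * (N + 1)) * \<gamma> ^ 12 - 1) * \<tau> n (m + 1) (N + 1) * \<tau> n m (N + 1) = 0" for n m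
    using bilinear_n[of n m "N + 1"] bilinear_m[of n m "N + 1"]
    by (simp_all add: A_def B_def \<kappa>_def add.commute)
  have B: "B n m \<noteq> 0" for n m by (simp add: B_def)
  \<comment> \<open>The factors depending on \<open>N\<close>, \<open>\<gamma>\<close> and
    \<open>\<alpha> 1\<close> cancel, as do the extra \<open>Q ^ 2\<close> from the shifts in
    \<open>n\<close> and \<open>m\<close>; twelfth powers of \<open>\<alpha> 0\<close> and
    \<open>\<alpha> 2\<close> remain.\<close>
  have "A n m * A n (m + 1) / (B n m * B (n + 1) m) = q powi (2 * n - 2 * m) * a 0 ^ 2 * a 2 ^ 2"
  proof -
    define x y w where "x = Q powi n" and "y = Q powi m" and "w = Q powi N"
    have nz: "x \<noteq> 0" "y \<noteq> 0" "w \<noteq> 0" by (simp_all add: x_def y_def w_def)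
    have "q powi (2 * n - 2 * m) = Q powi (n * 12 - m * 12)"
      by (simp only: q_def power_int_power) (simp add: algebra_simps)
    also have "\<dots> = x ^ 12 / y ^ 12"
      by (simp add: x_def y_def power_int_diff power_int_mult)
    finally have q: "q powi (2 * n - 2 * m) = x ^ 12 / y ^ 12" .
    have A: "A n m = x ^ 4 / y ^ 2 / (w * Q) ^ 4 * \<gamma> powi (- 4) * \<alpha> 0 ^ 6 * \<alpha> 1 ^ 2 * \<alpha> 2 ^ 4"
      "A n (m + 1) = x ^ 4 / (y * Q) ^ 2 / (w * Q) ^ 4 * \<gamma> powi (- 4) * \<alpha> 0 ^ 6 * \<alpha> 1 ^ 2 * \<alpha> 2 ^ 4"
      and B: "B n m = y ^ 4 / x ^ 2 / (w * Q) ^ 4 * \<gamma> powi (- 4) * \<alpha> 1 ^ 2 * \<alpha> 2 powi (- 2)"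
      "B (n + 1) m = y ^ 4 / (x * Q) ^ 2 / (w * Q) ^ 4 * \<gamma> powi (- 4) * \<alpha> 1 ^ 2 * \<alpha> 2 powi (- 2)"
      unfolding A_def B_def x_def y_def w_def mult.commute[of 2] mult.commute[of 4]
      by (simp_all only: power_int_diff power_int_mult power_int_add Q_nonzero simp_thms power_int_1_right power_int_numeral)
    show ?thesis
    proof -
      have "(x ^ 4 / y ^ 2 / (w * Q) ^ 4 * g * p ^ 6 * r ^ 2 * l ^ 4) *
          (x ^ 4 / (y * Q) ^ 2 / (w * Q) ^ 4 * g * p ^ 6 * r ^ 2 * l ^ 4) /
          ((y ^ 4 / x ^ 2 / (w * Q) ^ 4 * g * r ^ 2 * (1 / l ^ 2)) *
           (y ^ 4 / (x * Q) ^ 2 / (w * Q) ^ 4 * g * r ^ 2 * (1 / l ^ 2))) =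
          x ^ 12 / y ^ 12 * (p ^ 6) ^ 2 * (l ^ 6) ^ 2"
        if "g \<noteq> 0" "p \<noteq> 0" "r \<noteq> 0" "l \<noteq> 0" for g p r l
        using nz that by (simp add: field_simps) (simp add: algebra_simps eval_nat_numeral)
      from this[of "\<gamma> powi (-4)" "\<alpha> 0" "\<alpha> 1" "\<alpha> 2"] show ?thesis
        unfolding q A B a_def by (simp add: power_int_minus divide_inverse)
    qed
  qed
  then show ?thesis
    unfolding z'
    using schwarzian_kdv_of_bilinear[OF e(1)[of n m] e(1)[of n "m + 1"] e(2)[of n m] e(2)[of "n + 1" m]
      \<tau>_nonzero \<tau>_nonzero \<tau>_nonzero \<tau>_nonzero \<tau>_nonzero \<tau>_nonzero \<tau>_nonzero \<tau>_nonzero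
      Q_\<gamma>_nonzero K \<kappa> B B]
    by simp
qed

theorem theorem3p1:
  shows
    "(\<forall>n m N :: int.
        \<tau> n m (N + 1) * \<tau> (n + 1) m (N - 1)
        - Q powi (4 * N) * \<gamma> ^ 4 * \<tau> (n + 1) m (N + 1) * \<tau> n m (N - 1)
        + Q powi (4 * n - 2 * m - 4 * N) * \<gamma> powi (- 4) * \<alpha> 0 ^ 6 * \<alpha> 1 ^ 2 * \<alpha> 2 ^ 4
          * (Q powi (12 * N) * \<gamma> ^ 12 - 1) * \<tau> (n + 1) m N * \<tau> n m N = 0) \<and>
     (\<forall>n m N :: int.
        \<tau> n m (N + 1) * \<tau> n (m + 1) (N - 1)
        - Q powi (4 * N) * \<gamma> ^ 4 * \<tau> n (m + 1) (N + 1) * \<tau> n m (N - 1)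
        + Q powi (4 * m - 2 * n - 4 * N) * \<gamma> powi (- 4) * \<alpha> 1 ^ 2 * \<alpha> 2 powi (- 2)
          * (Q powi (12 * N) * \<gamma> ^ 12 - 1) * \<tau> n (m + 1) N * \<tau> n m N = 0) \<and>
     (\<forall>N n m :: int.
        (z N n m - z N (n + 1) m) * (z N (n + 1) (m + 1) - z N n (m + 1))
        / ((z N (n + 1) m - z N (n + 1) (m + 1)) * (z N n (m + 1) - z N n m))
        = q powi (2 * n - 2 * m) * a 0 ^ 2 * a 2 ^ 2)"
  using bilinear_n bilinear_m schwarzian_kdv by blast

end
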